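(* (i) Let $\mathcal{M}$ be a class of finite groups containing all finite direct products of distinct extraspecial groups of the form $M_{p^3}$, where $p$ is an odd prime (that is, all groups $M_{q_1^3}\times\cdots\times M_{q_r^3}$ with $q_1,\ldots,q_r$ pairwise distinct odd primes), and let $\mathcal{C}$ be a class of finite groups such that $\mathcal{M}\subseteq\mathcal{C}$. Then the set $CD_{\mathcal{C}}=\{\mathrm{cdeg}(G)\mid G\in\mathcal{C}\}$ is dense in $[0,1]$. (ii) Let $a\in[0,1]$. Then there exists a sequence $(G_n)_{n\geq 1}$ of finite groups such that $\lim_{n\to\infty}\mathrm{cdeg}(G_n)=a$.
   Context: For an odd prime $p$, $M_{p^3}=\langle x,y\mid x^{p^2}=y^p=1,\ y^{-1}xy=x^{p+1}\rangle$ is the modular $p$-group of order $p^3$. For a finite group $G$, the cyclicity degree of $G$ is $\mathrm{cdeg}(G)=\frac{|C(G)|}{|L(G)|}$, where $C(G)$ is the set of cyclic subgroups of $G$ and $L(G)$ is the set of all subgroups of $G$. Density in $[0,1]$ is with respect to the usual topology of $\mathbb{R}$. *)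

theory Defs
  imports
    "HOL-Analysis.Analysis"
    "HOL-Algebra.Product_Groups"
    "HOL-Computational_Algebra.Primes"
begin

section \<open>Groups given by generators and relations\<close>

text \<open>Words in the generators and their formal inverses; concatenation is the product, the empty
  word is the identity. The group presented by a set \<open>R\<close> of relations \<open>u = v\<close> consists of
  the classes of words modulo the least congruence that contains \<open>R\<close> and cancels each
  letter against its formal inverse. All elements of the type \<open>'g\<close> are generators.\<close>

datatype 'g letter = Gen 'g | Inv 'g

inductive word_eq :: "('g letter list \<times> 'g letter list) set \<Rightarrow> 'g letter list \<Rightarrow> 'g letter list \<Rightarrow> bool"
  for R where
  refl: "word_eq R u u"
| sym: "word_eq R u v \<Longrightarrow> word_eq R v u"
| trans: "word_eq R u v \<Longrightarrow> word_eq R v w \<Longrightarrow> word_eq R u w"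
| cong: "word_eq R u u' \<Longrightarrow> word_eq R v v' \<Longrightarrow> word_eq R (u @ v) (u' @ v')"
| gen_inv: "word_eq R [Gen g, Inv g] []"
| inv_gen: "word_eq R [Inv g, Gen g] []"
| rel: "(u, v) \<in> R \<Longrightarrow> word_eq R u v"

definition word_class :: "('g letter list \<times> 'g letter list) set \<Rightarrow> 'g letter list \<Rightarrow> 'g letter list set"
  where "word_class R u = {w. word_eq R u w}"

definition presented_group ::
    "('g letter list \<times> 'g letter list) set \<Rightarrow> 'g letter list set monoid"
  where "presented_group R =
    \<lparr>carrier = range (word_class R),
     monoid.mult = (\<lambda>A B. {w. \<exists>u\<in>A. \<exists>v\<in>B. word_eq R (u @ v) w}),
     one = word_class R []\<rparr>"

lemma word_class_eq_iff: "word_class R u = word_class R v \<longleftrightarrow> word_eq R u v"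
  unfolding word_class_def by (auto intro: word_eq.intros)

lemma mult_word_class:
  "word_class R u \<otimes>\<^bsub>presented_group R\<^esub> word_class R v = word_class R (u @ v)"
  unfolding presented_group_def word_class_def
  by (auto intro: word_eq.refl) (blast intro: word_eq.cong word_eq.trans)

lemma group_presented_group: "group (presented_group R)"
proof -
  have carr: "carrier (presented_group R) = range (word_class R)"
    and one: "\<one>\<^bsub>presented_group R\<^esub> = word_class R []"
    by (simp_all add: presented_group_def)
  have linv: "\<exists>v. word_eq R (v @ u) []" for u
  proof (induction u)
    case Nil
    have "word_eq R ([] @ []) []" by (simp add: word_eq.refl)
    then show ?case by blast
  next
    case (Cons l u)
    then obtain v where v: "word_eq R (v @ u) []" by blast
    obtain k where k: "word_eq R ([k] @ [l]) []"
      by (cases l) (auto intro: word_eq.gen_inv word_eq.inv_gen)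
    have "word_eq R (v @ (([k] @ [l]) @ u)) (v @ ([] @ u))"
      by (intro word_eq.cong word_eq.refl k)
    with v have "word_eq R ((v @ [k]) @ (l # u)) []"
      using word_eq.trans by fastforce
    then show ?case by blast
  qed
  show ?thesis
  proof (rule groupI)
    fix x assume "x \<in> carrier (presented_group R)"
    then obtain u where u: "x = word_class R u" by (auto simp: carr)
    obtain v where v: "word_eq R (v @ u) []" using linv by blast
    show "\<exists>y\<in>carrier (presented_group R). y \<otimes>\<^bsub>presented_group R\<^esub> x = \<one>\<^bsub>presented_group R\<^esub>"
      using v by (auto simp: u carr one mult_word_class word_class_eq_iff)
  qed (auto simp: carr one mult_word_class)
qed

section \<open>The modular groups of order \<open>p\<^sup>3\<close>\<close>

datatype xy = X_gen | Y_gen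

text \<open>\<open>\<langle>x, y | x^(p^2) = 1, y^p = 1, y^(-1) x y = x^(p+1)\<rangle>\<close>\<close>

definition modular_group :: "nat \<Rightarrow> xy letter list set monoid"
  where "modular_group p = presented_group
    {(replicate (p^2) (Gen X_gen), []),
     (replicate p (Gen Y_gen), []),
     ([Inv Y_gen, Gen X_gen, Gen Y_gen], replicate (p + 1) (Gen X_gen))}"

section \<open>Cyclicity degree\<close>

definition subgroups :: "('a, 'b) monoid_scheme \<Rightarrow> 'a set set"
  where "subgroups G = {H. subgroup H G}"

definition cyclic_subgroups :: "('a, 'b) monoid_scheme \<Rightarrow> 'a set set"
  where "cyclic_subgroups G = {H. subgroup H G \<and> cyclic_group (G\<lparr>carrier := H\<rparr>)}"

definition cdeg :: "('a, 'b) monoid_scheme \<Rightarrow> real"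
  where "cdeg G = real (card (cyclic_subgroups G)) / real (card (subgroups G))"

definition CD :: "('a, 'b) monoid_scheme set \<Rightarrow> real set"
  where "CD \<C> = {cdeg G | G. G \<in> \<C>}"

definition class_of_finite_groups :: "('a, 'b) monoid_scheme set \<Rightarrow> bool"
  where "class_of_finite_groups \<C> \<longleftrightarrow> (\<forall>G\<in>\<C>. group G \<and> finite (carrier G))"

text \<open>The groups of a class share a carrier type, so containment of a given group is
  understood up to isomorphism. The index set \<open>Q\<close> consists of the pairwise distinct primes
  \<open>q\<^sub>1, \<dots>, q\<^sub>r\<close> with \<open>r \<ge> 1\<close>.\<close>

definition contains_modular_products :: "('a, 'b) monoid_scheme set \<Rightarrow> bool"
  where "contains_modular_products \<M> \<longleftrightarrow>
    (\<forall>Q::nat set. finite Q \<and> Q \<noteq> {} \<and> (\<forall>q\<in>Q. prime q \<and> odd q) \<longrightarrow>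
       (\<exists>G\<in>\<M>. G \<cong> product_group Q modular_group))"

end

theory Submission
  imports Defs "HOL-Algebra.Multiplicative_Group" "HOL-Number_Theory.Cong"
    "HOL-Computational_Algebra.Squarefree"
begin

text \<open>The group \<open>M\<^bsub>p\<^sup>3\<^esub>\<close> has \<open>2p + 4\<close> subgroups. All are cyclic except
  the whole group and the subgroup \<open>\<Omega>\<close> of the \<open>p\<^sup>2\<close> elements of exponent \<open>p\<close>: the \<open>p\<^sup>2 - 1\<close>
  elements of order \<open>p\<close> make up \<open>p + 1\<close> cyclic groups, the \<open>p\<^sup>3 - p\<^sup>2\<close> elements of order
  \<open>p\<^sup>2\<close> make up \<open>p\<close>. Hence its cyclicity degree is \<open>(p + 1) / (p + 2)\<close>. Every subgroup of
  a direct product of groups of coprime orders is a product of subgroups, so the cyclicity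
  degree is multiplicative on such products. As the sum of the reciprocals of the primes diverges,
  the products of \<open>(p + 1) / (p + 2)\<close> over the primes \<open>N \<le> p < n\<close> decrease from \<open>1\<close> to \<open>0\<close> as
  \<open>n\<close> grows, in steps of size at most \<open>1 / (N + 2)\<close>; so they come arbitrarily close to every
  point of the unit interval. Part (ii) is part (i) for the class of all finite groups on sets of
  natural numbers.\<close>

section \<open>Products over primes\<close>

text \<open>Telescoping: \<open>1 / (n + 1)^2\<close> is at most \<open>1 / n - 1 / (n + 1)\<close>.
  The induction therefore carries the sharper bound \<open>2 - 1 / n\<close>; the empty sum is
  treated apart.\<close>

lemma sum_inverse_squares_le: "(\<Sum>m=1..n. 1 / real m ^ 2) \<le> 2"
proof -
  have "(\<Sum>m=1..n. 1 / real m ^ 2) \<le> 2 - 1 / real n" if "n \<ge> 1" for n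
    using that
  proof (induction n rule: dec_induct)
    case (step n)
    have "1 / real (Suc n) ^ 2 \<le> 1 / real n - 1 / real (Suc n)"
      using step.hyps by (simp add: divide_simps power2_eq_square)
    with step show ?case by simp
  qed simp
  from this[of n] show ?thesis
    by (cases "n \<ge> 1") (auto intro: order_trans)
qed

text \<open>All multiplicities are 1. A squarefree number can thus be replaced by the set of its
  primes, which turns sums over numbers into sums over sets of primes.\<close>

lemma squarefree_nat_eq_prod_prime_factors:
  fixes n :: nat
  assumes "squarefree n"
  shows "\<Prod>(prime_factors n) = n"
proof -
  have "n \<noteq> 0" using assms by (metis not_squarefree_0)
  then have "n = (\<Prod>p\<in>prime_factors n. p ^ multiplicity p n)"
    by (simp add: prime_factorization_nat)
  also have "\<dots> = (\<Prod>p\<in>prime_factors n. p)"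
    using assms \<open>n \<noteq> 0\<close> by (intro prod.cong) (auto simp: squarefree_factorial_semiring')
  finally show ?thesis by simp
qed

text \<open>A number is determined by its square part and the prime factors of its squarefree part, and
  the sum of the inverse squares is at most 2.\<close>

lemma harm_le_prime_product:
  "harm n \<le> 2 * (\<Prod>p | prime p \<and> p \<le> n. 1 + 1 / real p)"
proof -
  define A where "A = {p::nat. prime p \<and> p \<le> n}"
  have finA: "finite A" unfolding A_def by simp
  define \<phi> where "\<phi> k = (prime_factors (squarefree_part k), square_part k)" for k :: nat
  \<comment> \<open>The weight of a pair is the reciprocal of the number
    \<open>\<Prod>X * m^2\<close> that it encodes. It splits into a factor for X and a factor for m,
    so its sum over a rectangle factorizes.\<close>
  define w where "w = (\<lambda>(X, m). (\<Prod>p\<in>X. 1 / real p) * (1 / real m ^ 2))"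
  have part: "k = \<Prod>(fst (\<phi> k)) * snd (\<phi> k) ^ 2" for k
    using squarefree_decompose[of k] squarefree_nat_eq_prod_prime_factors[of "squarefree_part k"]
    by (simp add: \<phi>_def squarefree_squarefree_part)
  have inj: "inj_on \<phi> {1..n}"
    by (rule inj_onI) (metis part)
  have sub: "\<phi> ` {1..n} \<subseteq> Pow A \<times> {1..n}"
  proof safe
    fix k X m assume k: "k \<in> {1..n}" and eq: "(X, m) = \<phi> k"
    have dvd: "squarefree_part k dvd k" "square_part k dvd k"
      using squarefree_decompose[of k] by (metis dvd_triv_left, metis dvd_mult dvd_triv_left power2_eq_square)
    { fix p assume "p \<in> X"
      then have "prime p" "p dvd k"
        using eq dvd by (auto simp: \<phi>_def intro: dvd_trans)
      then show "p \<in> A" using k unfolding A_def by (auto dest: dvd_imp_le) }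
    show "m \<in> {1..n}"
      using eq k dvd by (auto simp: \<phi>_def Suc_le_eq dest: dvd_imp_le intro!: Nat.gr0I)
  qed
  have w: "w (\<phi> k) = 1 / real k" for k
    by (subst (2) part[of k]) (simp add: w_def case_prod_beta prod_dividef of_nat_prod)
  have "harm n = (\<Sum>k=1..n. w (\<phi> k))"
    by (simp add: harm_def w inverse_eq_divide)
  also have "\<dots> = sum w (\<phi> ` {1..n})" by (simp only: sum.reindex[OF inj] o_def)
  \<comment> \<open>The additional pairs, which encode numbers above n, contribute nonnegative
    terms.\<close>
  also have "\<dots> \<le> sum w (Pow A \<times> {1..n})"
    by (intro sum_mono2 sub) (auto simp: finA w_def intro!: divide_nonneg_nonneg prod_nonneg)
  also have "\<dots> = (\<Sum>X\<in>Pow A. \<Prod>p\<in>X. 1 / real p) * (\<Sum>m=1..n. 1 / real m ^ 2)"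
    by (simp add: w_def sum_product sum.cartesian_product)
  also have "\<dots> \<le> (\<Sum>X\<in>Pow A. \<Prod>p\<in>X. 1 / real p) * 2"
    by (intro mult_left_mono sum_inverse_squares_le sum_nonneg prod_nonneg) auto
  \<comment> \<open>Expanding the product selects 1 or \<open>1 / p\<close> from each factor, which
    gives one summand for each subset of A.\<close>
  also have "(\<Sum>X\<in>Pow A. \<Prod>p\<in>X. 1 / real p) = (\<Prod>p\<in>A. 1 + 1 / real p)"
    by (subst add.commute, subst prod_add[OF finA]) simp
  finally show ?thesis by (simp add: A_def mult.commute)
qed

text \<open>By \<open>1 + t \<le> exp t\<close>, the harmonic numbers are at most twice the
  exponential of the prime sum, so their divergence carries over.\<close>

lemma sum_inverse_primes_unbounded:
  fixes B :: real
  obtains n where "B < (\<Sum>p | prime p \<and> p \<le> n. 1 / real p)"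
proof -
  have "\<forall>\<^sub>F n in sequentially. 2 * exp B < (harm n :: real)"
    using harm_at_top by (simp add: filterlim_at_top_dense)
  then obtain n where "2 * exp B < (harm n :: real)"
    by (auto simp: eventually_sequentially)
  also have "\<dots> \<le> 2 * (\<Prod>p | prime p \<and> p \<le> n. 1 + 1 / real p)"
    by (rule harm_le_prime_product)
  also have "\<dots> \<le> 2 * (\<Prod>p | prime p \<and> p \<le> n. exp (1 / real p))"
    by (intro mult_left_mono prod_mono) (auto intro: exp_ge_add_one_self)
  also have "\<dots> = 2 * exp (\<Sum>p | prime p \<and> p \<le> n. 1 / real p)"
    by (simp add: exp_sum)
  finally show ?thesis using that by simp
qed

text \<open>For p at least 2, the factor \<open>1 - 1 / (p + 2)\<close> is at most
  \<open>1 - 1 / (2 * p)\<close>, hence at most \<open>exp (- 1 / (2 * p))\<close>. A large sum of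
  reciprocals thus makes the product small.\<close>

lemma prime_product_arbitrarily_small:
  fixes \<epsilon> :: real
  assumes "\<epsilon> > 0"
  obtains n where "(\<Prod>p | prime p \<and> N \<le> p \<and> p < n. (real p + 1) / (real p + 2)) < \<epsilon>"
proof -
  define C where "C = (\<Sum>p | prime p \<and> p < N. 1 / real p)"
  \<comment> \<open>Adding C compensates for the primes below N, which are absent from the product;
    the factor 2 cancels the halving in the exponent.\<close>
  obtain n where n: "C - 2 * ln \<epsilon> < (\<Sum>p | prime p \<and> p \<le> n. 1 / real p)"
    by (rule sum_inverse_primes_unbounded)
  \<comment> \<open>\<open>Suc n\<close> because the sum runs over primes up to and including n,
    whereas the product stops strictly before its bound.\<close>
  define S where "S = {p. prime p \<and> N \<le> p \<and> p < Suc n}"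
  have fin: "finite S" unfolding S_def by simp
  have "(\<Sum>p | prime p \<and> p \<le> n. 1 / real p) \<le> (\<Sum>p \<in> {p. prime p \<and> p < N} \<union> S. 1 / real p)"
    by (intro sum_mono2) (auto simp: S_def)
  also have "\<dots> = C + (\<Sum>p\<in>S. 1 / real p)"
    unfolding C_def by (intro sum.union_disjoint) (auto simp: S_def)
  finally have big: "- 2 * ln \<epsilon> < (\<Sum>p\<in>S. 1 / real p)" using n by simp
  have "(\<Prod>p\<in>S. (real p + 1) / (real p + 2)) \<le> (\<Prod>p\<in>S. exp (- (1 / real p) / 2))"
  proof (intro prod_mono conjI)
    fix p assume "p \<in> S"
    then have "p \<ge> 2" by (auto simp: S_def prime_ge_2_nat)
    then have "(real p + 1) / (real p + 2) \<le> 1 + (- (1 / real p) / 2)"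
      by (simp add: field_simps)
    also have "\<dots> \<le> exp (- (1 / real p) / 2)" by (rule exp_ge_add_one_self)
    finally show "(real p + 1) / (real p + 2) \<le> exp (- (1 / real p) / 2)" .
  qed simp
  also have "\<dots> = exp (- (\<Sum>p\<in>S. 1 / real p) / 2)"
    by (simp add: exp_sum[symmetric] fin sum_negf sum_divide_distrib)
  also have "\<dots> < exp (ln \<epsilon>)" using big by simp
  finally show ?thesis using assms that[of "Suc n"] by (simp add: S_def)
qed

text \<open>Primes from a large N on are multiplied in one by one until the product first drops
  below \<open>a + \<delta>\<close>. A single factor lowers the product by at most
  \<open>\<delta>\<close>, so it cannot have fallen below a.\<close>

lemma prime_products_dense:
  fixes a \<epsilon> :: real
  assumes a: "0 \<le> a" "a < 1" and "\<epsilon> > 0"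
  obtains Q :: "nat set" where "finite Q" "Q \<noteq> {}" "\<And>q. q \<in> Q \<Longrightarrow> prime q \<and> odd q"
    "\<bar>(\<Prod>q\<in>Q. (real q + 1) / (real q + 2)) - a\<bar> < \<epsilon>"
proof -
  \<comment> \<open>The second bound gives \<open>a + \<delta> < 1\<close>: the empty product lies
    above the threshold, so the set of primes found is nonempty.\<close>
  define \<delta> where "\<delta> = min (\<epsilon> / 2) ((1 - a) / 2)"
  have \<delta>: "0 < \<delta>" "\<delta> < \<epsilon>" "a + \<delta> < 1" using assms by (auto simp: \<delta>_def min_def field_simps)
  obtain N0 :: nat where N0: "1 / \<delta> < real N0" using reals_Archimedean2 by blast
  \<comment> \<open>\<open>N0\<close> keeps every step below \<open>\<delta>\<close>; the lower
    bound 3 excludes the prime 2.\<close>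
  define N where "N = max N0 3"
  have small: "1 / (real n + 2) \<le> \<delta>" if "n \<ge> N" for n
  proof -
    have "1 / \<delta> < real n + 2" using N0 that by (simp add: N_def)
    then show ?thesis using \<delta> by (simp add: field_simps)
  qed
  define S where "S n = {p. prime p \<and> N \<le> p \<and> p < n}" for n
  define P where "P n = (\<Prod>p\<in>S n. (real p + 1) / (real p + 2))" for n
  have finS: "finite (S n)" for n by (simp add: S_def)
  obtain n0 where "P n0 < a + \<delta>"
    using prime_product_arbitrarily_small[of "a + \<delta>" N] a \<delta> by (auto simp: P_def S_def)
  define n where "n = (LEAST n. P n < a + \<delta>)"
  have n: "P n < a + \<delta>" unfolding n_def by (rule LeastI) fact
  have "P 0 = 1" by (simp add: P_def S_def)
  have "n \<noteq> 0"
  proof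
    assume "n = 0"
    with n \<open>P 0 = 1\<close> \<delta> show False by simp
  qed
  then obtain m where m: "n = Suc m" by (cases n) auto
  have Pm: "P m \<ge> a + \<delta>"
    using not_less_Least[of m "\<lambda>n. P n < a + \<delta>"] m n_def by force
  have P01: "0 \<le> P m" "P m \<le> 1"
    unfolding P_def by (auto intro!: prod_nonneg prod_le_1)
  have "P m - \<delta> \<le> P (Suc m)"
  proof (cases "prime m \<and> N \<le> m")
    case True
    then have "S (Suc m) = insert m (S m)" by (auto simp: S_def)
    then have "P (Suc m) = P m * ((real m + 1) / (real m + 2))"
      by (simp add: P_def finS S_def)
    also have "\<dots> = P m - P m * (1 / (real m + 2))" by (simp add: field_simps)
    finally have "P (Suc m) = P m - P m * (1 / (real m + 2))" .
    moreover have "P m * (1 / (real m + 2)) \<le> 1 * \<delta>"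
      using P01 small[of m] True by (intro mult_mono) auto
    ultimately show ?thesis by simp
  next
    case False
    then have "S (Suc m) = S m" by (auto simp: S_def less_Suc_eq)
    then show ?thesis using \<delta> by (simp add: P_def)
  qed
  then have "\<bar>P n - a\<bar> < \<epsilon>" using n m Pm \<delta> by simp
  moreover have "S n \<noteq> {}" using n \<delta> by (auto simp: P_def)
  moreover have "prime q \<and> odd q" if "q \<in> S n" for q
    using that prime_odd_nat[of q] by (auto simp: S_def N_def)
  ultimately show ?thesis using that[of "S n"] finS by (simp add: P_def)
qed

section \<open>Cyclicity degrees of products\<close>

text \<open>Powers taken in a subgroup agree with powers in G. Cyclic subgroups can hence be handled
  through their generators, the form used for homomorphic images, products and counting.\<close>

lemma (in group) cyclic_subgroups_eq:
  "cyclic_subgroups G = (\<lambda>x. generate G {x}) ` carrier G"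
proof (intro equalityI subsetI)
  fix H assume "H \<in> cyclic_subgroups G"
  then have H: "subgroup H G" "cyclic_group (G\<lparr>carrier := H\<rparr>)"
    by (auto simp: cyclic_subgroups_def)
  interpret H: group "G\<lparr>carrier := H\<rparr>" using H(1) subgroup.subgroup_is_group is_group by blast
  obtain x where x: "x \<in> H" "H = range (\<lambda>n::int. x [^]\<^bsub>G\<lparr>carrier := H\<rparr>\<^esub> n)"
    using H(2) by (auto simp: H.cyclic_group)
  have "x [^]\<^bsub>G\<lparr>carrier := H\<rparr>\<^esub> n = x [^] n" for n :: int
    using int_pow_consistent[OF H(1) x(1)] by simp
  moreover have xG: "x \<in> carrier G" using subgroup.mem_carrier[OF H(1) x(1)] .
  ultimately have "H = generate G {x}"
    using x(2) generate_pow[OF xG] by auto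
  then show "H \<in> (\<lambda>x. generate G {x}) ` carrier G"
    using xG by (rule image_eqI)
next
  fix H assume "H \<in> (\<lambda>x. generate G {x}) ` carrier G"
  then obtain x where x: "x \<in> carrier G" "H = generate G {x}" by blast
  then have H: "subgroup H G" using generate_is_subgroup[of "{x}"] by simp
  interpret H: group "G\<lparr>carrier := H\<rparr>" using H subgroup.subgroup_is_group is_group by blast
  have xH: "x \<in> H" using x by (simp add: generate.incl)
  then have "x [^]\<^bsub>G\<lparr>carrier := H\<rparr>\<^esub> n = x [^] n" for n :: int
    using int_pow_consistent[OF H] by simp
  then have "carrier (G\<lparr>carrier := H\<rparr>) = range (\<lambda>n::int. x [^]\<^bsub>G\<lparr>carrier := H\<rparr>\<^esub> n)"
    using generate_pow[OF x(1)] x(2) by auto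
  with xH have "cyclic_group (G\<lparr>carrier := H\<rparr>)"
    unfolding H.cyclic_group by (intro bexI[of _ x]) simp_all
  then show "H \<in> cyclic_subgroups G" using H by (simp add: cyclic_subgroups_def)
qed

lemma cyclic_subgroups_subset: "cyclic_subgroups G \<subseteq> subgroups G"
  by (auto simp: cyclic_subgroups_def subgroups_def)

lemma subgroups_subset_Pow: "subgroups G \<subseteq> Pow (carrier G)"
  by (auto simp: subgroups_def dest: subgroup.subset)

lemma finite_subgroups: "finite (carrier G) \<Longrightarrow> finite (subgroups G)"
  using subgroups_subset_Pow by (metis finite_Pow_iff finite_subset)

lemma cdeg_bounds:
  assumes "finite (carrier G)"
  shows "cdeg G \<in> {0..1}"
  using card_mono[OF finite_subgroups[OF assms] cyclic_subgroups_subset]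
  by (auto simp: cdeg_def divide_le_eq)

text \<open>Taking images under an isomorphism is a bijection between the sets of subgroups, and it
  sends the subgroup generated by x to the one generated by \<open>h x\<close>.\<close>

lemma cdeg_iso:
  assumes "group G" "group H" "G \<cong> H"
  shows "cdeg G = cdeg H"
proof -
  interpret G: group G by fact
  interpret H: group H by fact
  obtain h where h: "h \<in> iso G H" using assms(3) by (auto simp: is_iso_def)
  interpret h: group_hom G H h using h by unfold_locales (simp add: iso_def)
  have bij: "bij_betw h (carrier G) (carrier H)" using h by (simp add: iso_def)
  have inj: "inj_on ((`) h) (subgroups G)"
    using bij subgroups_subset_Pow by (meson bij_betw_def inj_on_image_Pow inj_on_subset)
  define g where "g = inv_into (carrier G) h"
  have g: "g \<in> iso H G" using G.iso_set_sym[OF h] by (simp add: g_def)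
  interpret g: group_hom H G g using g by unfold_locales (simp add: iso_def)
  have hg: "h (g y) = y" if "y \<in> carrier H" for y
    using bij that by (simp add: g_def bij_betw_inv_into_right)
  have "(`) h ` subgroups G = subgroups H"
  proof (intro equalityI subsetI)
    fix K assume K: "K \<in> subgroups H"
    then have "K \<subseteq> carrier H" using subgroups_subset_Pow by auto
    then have "h ` g ` K = (\<lambda>y. y) ` K"
      unfolding image_image by (intro image_cong) (auto simp: hg)
    moreover have "g ` K \<in> subgroups G"
      using K g.subgroup_img_is_subgroup by (simp add: subgroups_def)
    ultimately show "K \<in> (`) h ` subgroups G" by (metis image_eqI image_ident)
  qed (auto simp: subgroups_def h.subgroup_img_is_subgroup)
  moreover have "(`) h ` cyclic_subgroups G = cyclic_subgroups H"
  proof -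
    have "(`) h ` cyclic_subgroups G = (\<lambda>x. generate H {h x}) ` carrier G"
      unfolding G.cyclic_subgroups_eq image_image
      using h.generate_img[of "{_}"] by (intro image_cong) auto
    also have "\<dots> = (\<lambda>x. generate H {x}) ` h ` carrier G" by (simp add: image_image)
    finally show ?thesis using bij by (simp add: H.cyclic_subgroups_eq bij_betw_def)
  qed
  ultimately show ?thesis
    using card_image[OF inj] card_image[OF inj_on_subset[OF inj cyclic_subgroups_subset]]
    by (simp add: cdeg_def)
qed

section \<open>Subgroups of direct products of coprime orders\<close>

lemma DirProd_nat_pow:
  "(a, b) [^]\<^bsub>G \<times>\<times> H\<^esub> (n::nat) = (a [^]\<^bsub>G\<^esub> n, b [^]\<^bsub>H\<^esub> n)"
  by (induction n) (simp_all add: nat_pow_def)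

lemma (in group) nat_pow_cong_0:
  assumes "x \<in> carrier G" "[n = 0] (mod order G)"
  shows "x [^] (n::nat) = \<one>"
  using assms ord_dvd_group_order[of x] by (auto simp: pow_eq_id cong_0_iff)

lemma (in group) nat_pow_cong_1:
  assumes x: "x \<in> carrier G" and n: "[n = 1] (mod order G)"
  shows "x [^] (n::nat) = x"
proof -
  \<comment> \<open>Integers are used because n may be 0 when G is trivial, and natural subtraction
    would truncate.\<close>
  have "int (order G) dvd int 1 - int n"
    using n by (metis cong_iff_dvd_diff cong_int_iff cong_sym)
  then have "int (ord x) dvd int 1 - int n"
    using ord_dvd_group_order[OF x] by (meson dvd_trans int_dvd_int_iff)
  then have "x [^] int n = x [^] int 1" using int_pow_eq[OF x] by simp
  then show ?thesis using x unfolding int_pow_int by simp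
qed

text \<open>By the Chinese remainder theorem some exponent is 1 modulo one order and 0 modulo the
  other. The corresponding power of \<open>(a, b)\<close> keeps one coordinate and kills the other,
  so K contains both parts of each of its elements separately.\<close>

lemma subgroup_DirProd_coprime:
  assumes "group G" "group H" "finite (carrier G)" "finite (carrier H)"
    and cop: "coprime (order G) (order H)"
    and K: "subgroup K (G \<times>\<times> H)"
  shows "K = fst ` K \<times> snd ` K" "subgroup (fst ` K) G" "subgroup (snd ` K) H"
proof -
  interpret G: group G by fact
  interpret H: group H by fact
  interpret GH: group "G \<times>\<times> H" using assms(1,2) by (rule DirProd_group)
  interpret f: group_hom "G \<times>\<times> H" G fst
    by unfold_locales (auto simp: hom_def mult_DirProd')
  interpret s: group_hom "G \<times>\<times> H" H snd
    by unfold_locales (auto simp: hom_def mult_DirProd')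
  show "subgroup (fst ` K) G" "subgroup (snd ` K) H"
    using K f.subgroup_img_is_subgroup s.subgroup_img_is_subgroup by auto
  have pow: "x [^]\<^bsub>G \<times>\<times> H\<^esub> (n::nat) \<in> K" if "x \<in> K" for x n
  proof (induction n)
    case 0
    show ?case using subgroup.one_closed[OF K] by simp
  next
    case (Suc n)
    show ?case using subgroup.m_closed[OF K Suc that] by simp
  qed
  have *: "(a, \<one>\<^bsub>H\<^esub>) \<in> K \<and> (\<one>\<^bsub>G\<^esub>, b) \<in> K" if ab: "(a, b) \<in> K" for a b
  proof
    have aG: "a \<in> carrier G" and bH: "b \<in> carrier H" using subgroup.mem_carrier[OF K ab] by auto
    obtain n where "[n = 1] (mod order G)" "[n = 0] (mod order H)"
      using binary_chinese_remainder_nat[OF cop] by blast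
    then show "(a, \<one>\<^bsub>H\<^esub>) \<in> K"
      using pow[OF ab, of n] G.nat_pow_cong_1[OF aG] H.nat_pow_cong_0[OF bH]
      by (simp add: DirProd_nat_pow)
    obtain m where "[m = 0] (mod order G)" "[m = 1] (mod order H)"
      using binary_chinese_remainder_nat[OF cop] by blast
    then show "(\<one>\<^bsub>G\<^esub>, b) \<in> K"
      using pow[OF ab, of m] G.nat_pow_cong_0[OF aG] H.nat_pow_cong_1[OF bH]
      by (simp add: DirProd_nat_pow)
  qed
  show "K = fst ` K \<times> snd ` K"
  proof (intro equalityI subsetI)
    fix z assume "z \<in> fst ` K \<times> snd ` K"
    then obtain a b a' b' where z: "z = (a, b)" "(a, b') \<in> K" "(a', b) \<in> K" by force
    then have "(a, \<one>\<^bsub>H\<^esub>) \<otimes>\<^bsub>G \<times>\<times> H\<^esub> (\<one>\<^bsub>G\<^esub>, b) \<in> K"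
      using * by (intro subgroup.m_closed[OF K]) blast+
    moreover have "a \<in> carrier G" "b \<in> carrier H"
      using z subgroup.mem_carrier[OF K] by fastforce+
    ultimately show "z \<in> K" using z by simp
  qed force
qed

text \<open>The map sending \<open>(A, B)\<close> to \<open>A \<times> B\<close> is a bijection from
  pairs of subgroups onto the subgroups of the product. It matches cyclic pairs with cyclic
  subgroups, since the subgroup generated by \<open>(a, b)\<close> is the product of its
  projections.\<close>

lemma cdeg_DirProd_coprime:
  assumes "group G" "group H" "finite (carrier G)" "finite (carrier H)"
    and cop: "coprime (order G) (order H)"
  shows "cdeg (G \<times>\<times> H) = cdeg G * cdeg H"
proof -
  interpret G: group G by fact
  interpret H: group H by fact
  interpret GH: group "G \<times>\<times> H" using assms(1,2) by (rule DirProd_group)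
  interpret f: group_hom "G \<times>\<times> H" G fst
    by unfold_locales (auto simp: hom_def mult_DirProd')
  interpret s: group_hom "G \<times>\<times> H" H snd
    by unfold_locales (auto simp: hom_def mult_DirProd')
  note K = subgroup_DirProd_coprime[OF assms]
  define f where "f = (\<lambda>(A, B). A \<times> B :: ('a \<times> 'c) set)"
  \<comment> \<open>A rectangle determines its sides only if both are nonempty, which the neutral
    elements ensure.\<close>
  have ne: "A \<noteq> {}" if "A \<in> subgroups G" for A
    using that subgroup.one_closed by (force simp: subgroups_def)
  have ne': "A \<noteq> {}" if "A \<in> subgroups H" for A
    using that subgroup.one_closed by (force simp: subgroups_def)
  have inj: "inj_on f (subgroups G \<times> subgroups H)"
    by (rule inj_onI) (auto simp: f_def times_eq_iff dest: ne ne')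
  have "f ` (subgroups G \<times> subgroups H) = subgroups (G \<times>\<times> H)"
  proof (intro equalityI subsetI)
    fix L assume "L \<in> subgroups (G \<times>\<times> H)"
    then have L: "subgroup L (G \<times>\<times> H)" by (simp add: subgroups_def)
    show "L \<in> f ` (subgroups G \<times> subgroups H)"
      by (rule image_eqI[of _ _ "(fst ` L, snd ` L)"]) (use K[OF L] in \<open>auto simp: f_def subgroups_def\<close>)
  qed (auto simp: f_def subgroups_def intro: DirProd_subgroups assms(1,2))
  moreover have "f ` (cyclic_subgroups G \<times> cyclic_subgroups H) = cyclic_subgroups (G \<times>\<times> H)"
  proof -
    have gen: "generate (G \<times>\<times> H) {(a, b)} = generate G {a} \<times> generate H {b}"
      if "a \<in> carrier G" "b \<in> carrier H" for a b
    proof -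
      have ab: "{(a, b)} \<subseteq> carrier (G \<times>\<times> H)" using that by simp
      show ?thesis
        using K(1)[OF GH.generate_is_subgroup[OF ab]] f.generate_img[OF ab] s.generate_img[OF ab] by simp
    qed
    have "f ` (cyclic_subgroups G \<times> cyclic_subgroups H)
        = (\<lambda>(a, b). generate G {a} \<times> generate H {b}) ` (carrier G \<times> carrier H)"
      by (auto simp: f_def G.cyclic_subgroups_eq H.cyclic_subgroups_eq image_iff split: prod.splits)
    also have "\<dots> = (\<lambda>x. generate (G \<times>\<times> H) {x}) ` (carrier G \<times> carrier H)"
      by (intro image_cong) (auto simp: gen)
    finally show ?thesis by (simp add: GH.cyclic_subgroups_eq)
  qed
  ultimately have "card (subgroups (G \<times>\<times> H)) = card (subgroups G \<times> subgroups H)"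
    "card (cyclic_subgroups (G \<times>\<times> H)) = card (cyclic_subgroups G \<times> cyclic_subgroups H)"
    using card_image[OF inj] card_image[OF inj_on_subset[OF inj]]
    by (metis, metis Sigma_mono cyclic_subgroups_subset)
  then show ?thesis by (simp add: cdeg_def card_cartesian_product)
qed

text \<open>Coordinate q is split off, with inverse \<open>g(q := a)\<close>. The elements are
  extensional functions, so the other component has to be restricted to Q.\<close>

lemma product_group_insert_iso:
  assumes "q \<notin> Q"
  shows "product_group (insert q Q) f \<cong> f q \<times>\<times> product_group Q f"
proof (rule is_isoI)
  let ?h = "\<lambda>x. (x q, restrict x Q)"
  show "?h \<in> iso (product_group (insert q Q) f) (f q \<times>\<times> product_group Q f)"
  proof (rule isoI)
    show "?h \<in> hom (product_group (insert q Q) f) (f q \<times>\<times> product_group Q f)"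
      using assms by (auto simp: hom_def PiE_iff intro!: restrict_ext)
    show "bij_betw ?h (carrier (product_group (insert q Q) f)) (carrier (f q \<times>\<times> product_group Q f))"
      using assms
      by (intro bij_betw_byWitness[where f' = "\<lambda>(a, g). g(q := a)"])
        (auto simp: fun_eq_iff PiE_iff extensional_def split: if_splits)
  qed
qed

lemma cdeg_product_group_coprime:
  assumes "finite Q" "\<And>q. q \<in> Q \<Longrightarrow> group (f q)" "\<And>q. q \<in> Q \<Longrightarrow> finite (carrier (f q))"
    and "pairwise (\<lambda>p q. coprime (order (f p)) (order (f q))) Q"
  shows "cdeg (product_group Q f) = (\<Prod>q\<in>Q. cdeg (f q))"
  using assms
proof (induction Q rule: finite_induct)
  \<comment> \<open>The empty product is the trivial group on the constant \<open>undefined\<close>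
    function; its only subgroup is cyclic, so its degree is 1, the empty product of reals.\<close>
  case empty
  interpret group "product_group {} f" by (rule product_group) simp
  have "subgroups (product_group {} f) = {{\<lambda>_. undefined}}"
  proof (intro equalityI subsetI)
    fix H assume "H \<in> subgroups (product_group {} f)"
    then show "H \<in> {{\<lambda>_. undefined}}"
      using subgroup.subset[of H "product_group {} f"] subgroup.one_closed[of H "product_group {} f"]
      by (auto simp: subgroups_def)
  next
    fix H assume "H \<in> {{\<lambda>_::'a. undefined :: 'b}}"
    then show "H \<in> subgroups (product_group {} f)"
      using subgroup_self by (simp add: subgroups_def)
  qed
  moreover have "{\<lambda>_. undefined} \<in> cyclic_subgroups (product_group {} f)"
    using generate_one one_closed
    unfolding cyclic_subgroups_eq by (intro image_eqI[of _ _ "\<lambda>_. undefined"]) (simp_all add: restrict_def)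
  ultimately have "cyclic_subgroups (product_group {} f) = subgroups (product_group {} f)"
    using cyclic_subgroups_subset[of "product_group {} f"] by auto
  then show ?case using \<open>subgroups _ = _\<close> by (simp add: cdeg_def)
next
  case (insert q Q)
  have grp: "group (product_group Q f)" "group (product_group (insert q Q) f)"
    using insert.prems by (auto intro!: product_group)
  have fin: "finite (carrier (product_group Q f))"
    using insert by (auto intro: finite_PiE)
  have ord: "order (product_group Q f) = (\<Prod>p\<in>Q. order (f p))"
    using insert.hyps by (simp add: order_def card_PiE)
  have cop: "coprime (order (f q)) (order (product_group Q f))"
    unfolding ord using insert.hyps(2) insert.prems(3)
    by (intro prod_coprime_right) (auto simp: pairwise_insert)
  have "cdeg (product_group (insert q Q) f) = cdeg (f q \<times>\<times> product_group Q f)"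
    using insert grp by (intro cdeg_iso product_group_insert_iso DirProd_group) auto
  also have "\<dots> = cdeg (f q) * cdeg (product_group Q f)"
    using insert fin grp cop by (intro cdeg_DirProd_coprime) auto
  also have "cdeg (product_group Q f) = (\<Prod>q\<in>Q. cdeg (f q))"
    using insert.prems by (intro insert.IH) (auto simp: pairwise_insert)
  finally show ?case using insert.hyps by simp
qed

text \<open>Transport of structure along an injection into the naturals. It moves the products of
  modular groups, whose elements are functions into sets of words, to the carrier type used in part
  (ii).\<close>

lemma finite_group_iso_nat:
  assumes "group G" "finite (carrier G)"
  obtains H :: "nat monoid" where "group H" "finite (carrier H)" "H \<cong> G"
proof -
  interpret G: group G by fact
  obtain \<phi> :: "_ \<Rightarrow> nat" where inj: "inj_on \<phi> (carrier G)"
    using assms(2) finite_imp_inj_to_nat_seg by blast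
  define g where "g = inv_into (carrier G) \<phi>"
  define H where "H = \<lparr>carrier = \<phi> ` carrier G,
    monoid.mult = (\<lambda>a b. \<phi> (g a \<otimes>\<^bsub>G\<^esub> g b)), one = \<phi> \<one>\<^bsub>G\<^esub>\<rparr>"
  have g: "g (\<phi> x) = x" if "x \<in> carrier G" for x
    using inj that by (simp add: g_def)
  have iso: "\<phi> \<in> iso G H"
    by (auto simp: iso_def hom_def H_def g inj inj_on_imp_bij_betw)
  have "group H"
  proof -
    have "monoid H" by unfold_locales (auto simp: H_def g G.m_assoc)
    then show ?thesis by (rule G.iso_imp_group[OF is_isoI[OF iso]])
  qed
  moreover have "H \<cong> G" using G.iso_sym is_isoI[OF iso] by blast
  ultimately show ?thesis using that assms(2) by (simp add: H_def)
qed

section \<open>Groups of order \<open>p\<^sup>3\<close> with \<open>p\<^sup>2\<close> elements of exponent \<open>p\<close>\<close>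

text \<open>Counting by fibres. In the application f maps an element to the cyclic subgroup it
  generates.\<close>

lemma card_eq_mult_card_image:
  assumes "finite S" "\<And>x. x \<in> S \<Longrightarrow> card {y \<in> S. f y = f x} = k"
  shows "card S = k * card (f ` S)"
proof -
  have "card S = (\<Sum>z\<in>f ` S. card {y \<in> S. f y = z})"
    using sum.image_gen[OF assms(1), of "\<lambda>_. 1 :: nat" f] by simp
  also have "\<dots> = (\<Sum>z\<in>f ` S. k)"
    using assms(2) by (intro sum.cong) auto
  finally show ?thesis by simp
qed

context group
begin

text \<open>The order of an element is the size of the subgroup it generates, and an inclusion of
  finite sets of equal size is an equality.\<close>

lemma generate_eq_iff_ord_eq:
  assumes "finite (carrier G)" "x \<in> carrier G" "y \<in> carrier G"
  shows "generate G {y} = generate G {x} \<longleftrightarrow> y \<in> generate G {x} \<and> ord y = ord x"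
proof
  assume "generate G {y} = generate G {x}"
  then show "y \<in> generate G {x} \<and> ord y = ord x"
    using assms by (metis generate.incl generate_pow_card insertI1)
next
  assume y: "y \<in> generate G {x} \<and> ord y = ord x"
  have "generate G {x} \<subseteq> carrier G" using generate_incl assms by simp
  then have "finite (generate G {x})" using assms(1) finite_subset by blast
  moreover have "generate G {y} \<subseteq> generate G {x}"
    using y assms by (intro generate_subgroup_incl generate_is_subgroup) auto
  ultimately show "generate G {y} = generate G {x}"
    using y assms generate_pow_card by (intro card_subset_eq) simp_all
qed

lemma generate_in_subgroup: "subgroup H G \<Longrightarrow> x \<in> H \<Longrightarrow> generate G {x} \<subseteq> H"
  by (intro generate_subgroup_incl) auto

text \<open>The elements generating the same subgroup as x are the elements of order d inside it, so
  k is the number of generators of each cyclic subgroup of order d.\<close>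

lemma card_cyclic_subgroups_of_ord:
  assumes "finite (carrier G)" and S: "S = {x \<in> carrier G. ord x = d}"
    and k: "\<And>x. x \<in> S \<Longrightarrow> card {y \<in> generate G {x}. ord y = d} = k"
  shows "card S = k * card ((\<lambda>x. generate G {x}) ` S)"
proof (rule card_eq_mult_card_image)
  show "finite S" using assms by simp
  fix x assume x: "x \<in> S"
  then have "generate G {x} \<subseteq> carrier G" using generate_incl S by simp
  then have "{y \<in> S. generate G {y} = generate G {x}} = {y \<in> generate G {x}. ord y = d}"
    using x assms(1) generate_eq_iff_ord_eq[of x] by (auto simp: S)
  with k[OF x] show "card {y \<in> S. generate G {y} = generate G {x}} = k" by simp
qed

text \<open>Stated for an abstract group so that it can be applied to a concrete model. Cyclic
  subgroups are counted by dividing the number of elements of each order by the number of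
  generators.\<close>

lemma card_subgroups_order_p_cubed:
  fixes p :: nat
  defines "\<Omega> \<equiv> {x \<in> carrier G. x [^] p = \<one>}"
  assumes p: "prime p" and ord_G: "order G = p ^ 3"
    and \<Omega>: "subgroup \<Omega> G" "card \<Omega> = p\<^sup>2"
    and exp: "\<And>x. x \<in> carrier G \<Longrightarrow> x [^] (p\<^sup>2) = \<one>"
  shows "card (cyclic_subgroups G) = 2 * p + 2" "card (subgroups G) = 2 * p + 4"
proof -
  let ?gen = "\<lambda>x. generate G {x}"
  have p1: "p > 1" using p by (rule prime_gt_1_nat)
  then have p2: "1 < p\<^sup>2" "p < p\<^sup>2" "p\<^sup>2 < p ^ 3" using power_strict_increasing[of 0 2 p] power_strict_increasing[of 1 2 p] power_strict_increasing[of 2 3 p]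
    by simp_all
  have fin: "finite (carrier G)"
    using ord_G p1 by (auto simp: order_def intro: card_ge_0_finite)
  have ord_cases: "ord x = 1 \<or> ord x = p \<or> ord x = p\<^sup>2" if "x \<in> carrier G" for x
  proof -
    have "ord x dvd p\<^sup>2" using exp[OF that] that by (simp add: pow_eq_id)
    then obtain i where "i \<le> 2" "ord x = p ^ i" using p by (auto simp: divides_primepow_nat)
    then show ?thesis by (auto simp: le_Suc_eq numeral_2_eq_2)
  qed
  have \<Omega>_iff: "x \<in> \<Omega> \<longleftrightarrow> ord x = 1 \<or> ord x = p" if "x \<in> carrier G" for x
    using that p by (auto simp: \<Omega>_def pow_eq_id prime_nat_iff)
  have ord1: "ord x = Suc 0 \<longleftrightarrow> x = \<one>" if "x \<in> carrier G" for x
    using ord_eq_1[OF that] by simp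
  have gen_card: "card (?gen x) = ord x" if "x \<in> carrier G" for x
    using generate_pow_card[OF that] by simp
  have gen_sub: "?gen x \<subseteq> carrier G" if "x \<in> carrier G" for x
    using generate_incl that by simp
  have gen_fin: "finite (?gen x)" if "x \<in> carrier G" for x
    using gen_sub[OF that] fin finite_subset by blast
  have \<Omega>_sub: "\<Omega> \<subseteq> carrier G" by (auto simp: \<Omega>_def)
  define S where "S d = {x \<in> carrier G. ord x = d}" for d
  have S1: "S 1 = {\<one>}" by (auto simp: S_def ord1)
  have Sp: "S p = \<Omega> - {\<one>}"
    using p1 \<Omega>_sub by (auto simp: S_def \<Omega>_iff ord1)
  have Sp2: "S (p\<^sup>2) = carrier G - \<Omega>"
    using p1 p2 \<Omega>_sub ord_cases by (auto simp: S_def \<Omega>_iff) metis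
  have card_Sp: "card (S p) = p\<^sup>2 - 1"
    unfolding Sp using \<Omega> subgroup.one_closed[OF \<Omega>(1)] by simp
  have card_Sp2: "card (S (p\<^sup>2)) = p ^ 3 - p\<^sup>2"
    unfolding Sp2 using ord_G \<Omega>_sub \<Omega>(2) fin by (simp add: card_Diff_subset finite_subset order_def)
  \<comment> \<open>A subgroup of order p lies in \<open>\<Omega>\<close>, so all its elements
    except the neutral one generate it.\<close>
  have gen_Sp: "card (S p) = (p - 1) * card (?gen ` S p)"
  proof (rule card_cyclic_subgroups_of_ord[OF fin])
    fix x assume x: "x \<in> S p"
    then have xG: "x \<in> carrier G" "ord x = p" by (auto simp: S_def)
    have "?gen x \<subseteq> \<Omega>" using xG \<Omega>_iff generate_in_subgroup[OF \<Omega>(1)] by blast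
    then have "{y \<in> ?gen x. ord y = p} = ?gen x - {\<one>}"
      using \<Omega>_sub p1 by (force simp: \<Omega>_iff ord1)
    then show "card {y \<in> ?gen x. ord y = p} = p - 1"
      using xG gen_card[of x] generate.one[of G "{x}"] by simp
  qed (simp add: S_def)
  then have np: "card (?gen ` S p) = p + 1"
  proof -
    have "p\<^sup>2 - 1 = (p - 1) * (p + 1)" by (simp add: algebra_simps power2_eq_square diff_mult_distrib)
    then have "(p - 1) * card (?gen ` S p) = (p - 1) * (p + 1)" using gen_Sp card_Sp by metis
    then show ?thesis using p1 by (metis mult_cancel1 less_irrefl zero_less_diff diff_is_0_eq not_le)
  qed
  have gen_Sp2: "card (S (p\<^sup>2)) = (p\<^sup>2 - p) * card (?gen ` S (p\<^sup>2))"
  proof (rule card_cyclic_subgroups_of_ord[OF fin])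
    fix x assume x: "x \<in> S (p\<^sup>2)"
    then have xG: "x \<in> carrier G" "ord x = p\<^sup>2" by (auto simp: S_def)
    \<comment> \<open>In a cyclic group of order \<open>p^2\<close> the elements of exponent p are
      the powers of \<open>x [^] p\<close>. They number p, and the other \<open>p^2 - p\<close>
      elements are the generators.\<close>
    have "?gen x \<inter> \<Omega> = ?gen (x [^] p)"
    proof (intro equalityI subsetI)
      fix y assume y: "y \<in> ?gen x \<inter> \<Omega>"
      then obtain k :: nat where k: "y = x [^] k"
        using generate_pow_on_finite_carrier[OF fin xG(1)] by auto
      then have "x [^] (k * p) = \<one>" using y xG by (simp add: \<Omega>_def nat_pow_pow)
      then have "p * p dvd k * p" using xG by (simp add: pow_eq_id power2_eq_square)
      then obtain j where "k = p * j" using p1 by auto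
      then have "y = (x [^] p) [^] j" using k xG by (simp add: nat_pow_pow)
      then show "y \<in> ?gen (x [^] p)"
        using generate_pow_on_finite_carrier[OF fin, of "x [^] p"] xG by auto
    next
      fix y assume y: "y \<in> ?gen (x [^] p)"
      have "x [^] p \<in> ?gen x"
        using generate_pow_on_finite_carrier[OF fin xG(1)] by blast
      moreover have "x [^] p \<in> \<Omega>" using xG exp by (simp add: \<Omega>_def nat_pow_pow power2_eq_square)
      moreover have "subgroup (?gen x) G" using xG generate_is_subgroup by simp
      ultimately show "y \<in> ?gen x \<inter> \<Omega>" using y generate_in_subgroup \<Omega>(1) by blast
    qed
    moreover have "ord (x [^] p) = p"
    proof -
      have "\<not> p\<^sup>2 dvd p" using p2 p1 by (auto dest: dvd_imp_le)
      then have "x [^] p \<noteq> \<one>" using xG by (simp add: pow_eq_id)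
      moreover have "x [^] p \<in> \<Omega>" using xG exp by (simp add: \<Omega>_def nat_pow_pow power2_eq_square)
      ultimately show ?thesis using xG \<Omega>_iff[of "x [^] p"] ord1[of "x [^] p"] by auto
    qed
    ultimately have "card (?gen x \<inter> \<Omega>) = p" using xG gen_card[of "x [^] p"] by simp
    moreover have "{y \<in> ?gen x. ord y = p\<^sup>2} = ?gen x - ?gen x \<inter> \<Omega>"
      using gen_sub[OF xG(1)] Sp2 by (auto simp: S_def)
    ultimately show "card {y \<in> ?gen x. ord y = p\<^sup>2} = p\<^sup>2 - p"
      using xG gen_card[of x] gen_fin[of x] by (simp add: card_Diff_subset)
  qed (simp add: S_def)
  then have np2: "card (?gen ` S (p\<^sup>2)) = p"
  proof -
    have "p ^ 3 - p\<^sup>2 = (p\<^sup>2 - p) * p"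
      by (simp add: algebra_simps power2_eq_square power3_eq_cube diff_mult_distrib)
    then have "(p\<^sup>2 - p) * card (?gen ` S (p\<^sup>2)) = (p\<^sup>2 - p) * p" using gen_Sp2 card_Sp2 by metis
    then show ?thesis using p2 by (metis mult_cancel1 diff_is_0_eq not_le)
  qed
  have "carrier G = S 1 \<union> S p \<union> S (p\<^sup>2)" using ord_cases by (auto simp: S_def)
  then have union: "cyclic_subgroups G = ?gen ` S 1 \<union> ?gen ` S p \<union> ?gen ` S (p\<^sup>2)"
    by (simp only: cyclic_subgroups_eq image_Un)
  have fin_gen: "finite (?gen ` S d)" for d using fin by (simp add: S_def)
  \<comment> \<open>Subgroups generated by elements of different orders have different
    sizes.\<close>
  have disj: "?gen ` S d \<inter> ?gen ` S e = {}" if "d \<noteq> e" for d e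
    using that gen_card by (auto simp: S_def) metis
  have "card (cyclic_subgroups G) = card (?gen ` S 1) + card (?gen ` S p) + card (?gen ` S (p\<^sup>2))"
  proof -
    have "?gen ` S 1 \<inter> ?gen ` S p = {}" "(?gen ` S 1 \<union> ?gen ` S p) \<inter> ?gen ` S (p\<^sup>2) = {}"
      using p1 p2 by (auto simp: Int_Un_distrib2 disj simp del: image_Int)
    then show ?thesis unfolding union using fin_gen by (simp only: card_Un_disjoint finite_Un)
  qed
  also have "card (?gen ` S 1) = 1" by (simp only: S1) simp
  finally show cyc: "card (cyclic_subgroups G) = 2 * p + 2" using np np2 by simp

  have cyc_card: "card H = 1 \<or> card H = p \<or> card H = p\<^sup>2" if H: "H \<in> cyclic_subgroups G" for H
  proof -
    obtain x where "x \<in> carrier G" "H = ?gen x" using H by (auto simp: cyclic_subgroups_eq)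
    then show ?thesis using ord_cases[of x] gen_card[of x] by simp
  qed
  have "subgroups G = cyclic_subgroups G \<union> {\<Omega>, carrier G}"
  proof (intro equalityI subsetI)
    fix H assume "H \<in> subgroups G"
    then have H: "subgroup H G" by (simp add: subgroups_def)
    note HG = subgroup.subset[OF H]
    have finH: "finite H" using HG fin finite_subset by blast
    have "card H dvd p ^ 3" using lagrange[OF H] ord_G by (metis dvd_triv_right)
    then obtain i where i: "i \<le> 3" "card H = p ^ i" using p by (auto simp: divides_primepow_nat)
    \<comment> \<open>H is cyclic if one of its elements has order \<open>card H\<close>. Otherwise
      its size is neither 1 nor p, and the remaining sizes \<open>p^2\<close> and \<open>p^3\<close>
      leave only \<open>\<Omega>\<close> and the whole group.\<close>
    show "H \<in> cyclic_subgroups G \<union> {\<Omega>, carrier G}"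
    proof (cases "\<exists>x\<in>H. ord x = card H")
      case True
      then obtain x where x: "x \<in> H" "ord x = card H" by blast
      then have xG: "x \<in> carrier G" using HG by blast
      have "?gen x = H"
        using x xG finH gen_card generate_in_subgroup[OF H] by (intro card_subset_eq) auto
      then show ?thesis using xG by (auto simp: cyclic_subgroups_eq)
    next
      case False
      \<comment> \<open>Lagrange's theorem inside H: the power with exponent \<open>card H\<close>
        is computed in the restricted group.\<close>
      have ord_dvd: "ord x dvd card H" if "x \<in> H" for x
      proof -
        interpret H: group "G\<lparr>carrier := H\<rparr>" using H subgroup.subgroup_is_group is_group by blast
        have "x [^]\<^bsub>G\<lparr>carrier := H\<rparr>\<^esub> order (G\<lparr>carrier := H\<rparr>) = \<one>"
          using H.pow_order_eq_1[of x] that by simp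
        then have "x [^] card H = \<one>"
          by (simp add: order_def nat_pow_def)
        then show ?thesis using that HG by (auto simp: pow_eq_id)
      qed
      have "i \<noteq> 0" 
      proof
        assume "i = 0"
        then show False using i False subgroup.one_closed[OF H] by (auto dest!: bspec[of _ _ \<one>])
      qed
      have "i \<noteq> 1"
      proof
        assume "i = 1"
        then have "card H = p" using i by simp
        have "H \<subseteq> {\<one>}"
        proof
          fix x assume x: "x \<in> H"
          then have "ord x dvd p" "ord x \<noteq> p" using ord_dvd[OF x] False \<open>card H = p\<close> by auto
          then show "x \<in> {\<one>}" using p x HG ord1[of x] by (auto simp: prime_nat_iff)
        qed
        then have "card H \<le> card {\<one>}" by (intro card_mono) auto
        then show False using p1 \<open>card H = p\<close> by simp
      qed
      consider "i = 2" | "i = 3" using i \<open>i \<noteq> 0\<close> \<open>i \<noteq> 1\<close> by linarith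
      then show ?thesis
      proof cases
        assume "i = 2"
        \<comment> \<open>H has no element of order \<open>p^2\<close>, since that is its own size;
          the inclusion is then an equality by cardinality.\<close>
        have "H \<subseteq> \<Omega>"
        proof
          fix x assume x: "x \<in> H"
          then have xG: "x \<in> carrier G" and "ord x \<noteq> p\<^sup>2" using HG False i \<open>i = 2\<close> by auto
          then show "x \<in> \<Omega>" using ord_cases[OF xG] \<Omega>_iff[OF xG] by auto
        qed
        then have "H = \<Omega>"
          using i \<open>i = 2\<close> \<Omega>(2) \<Omega>_sub fin finite_subset by (intro card_subset_eq) auto
        then show ?thesis by simp
      next
        assume "i = 3"
        then have "H = carrier G"
          using i HG ord_G fin by (intro card_subset_eq) (auto simp: order_def)
        then show ?thesis by simp
      qed
    qed
  qed (use \<Omega>(1) subgroup_self cyclic_subgroups_subset[of G] in \<open>auto simp: subgroups_def\<close>)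
  moreover have "\<Omega> \<notin> cyclic_subgroups G"
  proof
    assume "\<Omega> \<in> cyclic_subgroups G"
    then obtain x where x: "x \<in> carrier G" "\<Omega> = ?gen x" by (auto simp: cyclic_subgroups_eq)
    then have "x \<in> \<Omega>" using generate.incl[of x "{x}" G] by simp
    then show False using x \<Omega>_iff[of x] gen_card[of x] \<Omega>(2) p1 p2 by auto
  qed
  moreover have "carrier G \<notin> cyclic_subgroups G"
  proof
    assume "carrier G \<in> cyclic_subgroups G"
    from cyc_card[OF this] show False using ord_G p1 p2 unfolding order_def by linarith
  qed
  moreover have "\<Omega> \<noteq> carrier G" using \<Omega>(2) ord_G p2 by (auto simp: order_def)
  moreover have "finite (cyclic_subgroups G)"
    using finite_subgroups[OF fin] cyclic_subgroups_subset finite_subset by blast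
  ultimately show "card (subgroups G) = 2 * p + 4" using cyc by simp
qed

end

section \<open>A normal form for the modular groups\<close>

definition eval_letter :: "('a, 'b) monoid_scheme \<Rightarrow> ('g \<Rightarrow> 'a) \<Rightarrow> 'g letter \<Rightarrow> 'a" where
  "eval_letter G f l = (case l of Gen g \<Rightarrow> f g | Inv g \<Rightarrow> inv\<^bsub>G\<^esub> f g)"

definition eval_word :: "('a, 'b) monoid_scheme \<Rightarrow> ('g \<Rightarrow> 'a) \<Rightarrow> 'g letter list \<Rightarrow> 'a" where
  "eval_word G f w = foldr (\<lambda>l x. eval_letter G f l \<otimes>\<^bsub>G\<^esub> x) w \<one>\<^bsub>G\<^esub>"

context group
begin

lemma eval_word_Nil [simp]: "eval_word G f [] = \<one>"
  and eval_word_Cons [simp]: "eval_word G f (l # w) = eval_letter G f l \<otimes> eval_word G f w"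
  by (simp_all add: eval_word_def)

lemma eval_letter_closed: "range f \<subseteq> carrier G \<Longrightarrow> eval_letter G f l \<in> carrier G"
  by (auto simp: eval_letter_def split: letter.split)

lemma eval_word_closed: "range f \<subseteq> carrier G \<Longrightarrow> eval_word G f w \<in> carrier G"
  by (induction w) (simp_all add: eval_letter_closed)

lemma eval_word_append:
  "range f \<subseteq> carrier G \<Longrightarrow> eval_word G f (u @ v) = eval_word G f u \<otimes> eval_word G f v"
  by (induction u) (simp_all add: eval_letter_closed eval_word_closed m_assoc)

lemma eval_word_replicate_Gen:
  "range f \<subseteq> carrier G \<Longrightarrow> eval_word G f (replicate n (Gen g)) = f g [^] n"
proof (induction n)
  case (Suc n)
  then have "f g \<in> carrier G" by blast
  with Suc show ?case by (simp add: eval_letter_def flip: nat_pow_Suc2 del: nat_pow_Suc)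
qed simp

text \<open>Equality of values is a congruence that cancels inverse letters and contains R, hence
  contains the least such congruence.\<close>

lemma eval_word_cong:
  assumes f: "range f \<subseteq> carrier G"
    and R: "\<And>u v. (u, v) \<in> R \<Longrightarrow> eval_word G f u = eval_word G f v"
    and "word_eq R u v"
  shows "eval_word G f u = eval_word G f v"
  using assms(3)
proof induction
  case (gen_inv g)
  then show ?case using f by (simp add: eval_letter_def image_subset_iff)
next
  case (inv_gen g)
  then show ?case using f by (simp add: eval_letter_def image_subset_iff)
qed (simp_all add: eval_word_append f R)

text \<open>Von Dyck's theorem: an assignment of generators that respects the relations extends to a
  homomorphism.\<close>

lemma presented_group_hom:
  assumes f: "range f \<subseteq> carrier G"
    and R: "\<And>u v. (u, v) \<in> R \<Longrightarrow> eval_word G f u = eval_word G f v"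
  obtains h where "h \<in> hom (presented_group R) G"
    "\<And>w. h (word_class R w) = eval_word G f w"
proof -
  \<comment> \<open>An arbitrary representative is evaluated; by \<open>eval_word_cong\<close> the
    value does not depend on the choice.\<close>
  define h where "h A = eval_word G f (SOME w. w \<in> A)" for A
  have h: "h (word_class R w) = eval_word G f w" for w
  proof -
    have "word_eq R w (SOME v. v \<in> word_class R w)"
      unfolding word_class_def mem_Collect_eq by (rule someI, rule word_eq.refl)
    from eval_word_cong[OF f R this] show ?thesis by (simp add: h_def)
  qed
  have "h \<in> hom (presented_group R) G"
  proof (rule homI)
    fix A B assume "A \<in> carrier (presented_group R)" "B \<in> carrier (presented_group R)"
    then obtain u v where "A = word_class R u" "B = word_class R v"
      by (auto simp: presented_group_def)
    then show "h (A \<otimes>\<^bsub>presented_group R\<^esub> B) = h A \<otimes> h B"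
      by (simp add: mult_word_class h eval_word_append f)
  qed (auto simp: presented_group_def h eval_word_closed f)
  then show ?thesis using h that by blast
qed

end

section \<open>A concrete model of the modular group\<close>

text \<open>The pair \<open>(b, a)\<close> stands for \<open>y^b x^a\<close>; the product comes from \<open>x^a y^d = y^d x^(a (1 + p)^d)\<close>
  and \<open>(1 + p)^d \<equiv> 1 + d p (mod p^2)\<close>.\<close>

definition modular_model :: "nat \<Rightarrow> (int \<times> int) monoid" where
  "modular_model p = \<lparr>carrier = {0..<int p} \<times> {0..<(int p)\<^sup>2},
     monoid.mult = (\<lambda>(b, a) (d, c). ((b + d) mod int p, (a * (1 + d * int p) + c) mod (int p)\<^sup>2)),
     one = (0, 0)\<rparr>"

lemma carrier_modular_model: "carrier (modular_model p) = {0..<int p} \<times> {0..<(int p)\<^sup>2}"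
  and one_modular_model: "\<one>\<^bsub>modular_model p\<^esub> = (0, 0)"
  and mult_modular_model: "(b, a) \<otimes>\<^bsub>modular_model p\<^esub> (d, c) =
    ((b + d) mod int p, (a * (1 + d * int p) + c) mod (int p)\<^sup>2)"
  by (simp_all add: modular_model_def)

lemmas modular_model_simps = carrier_modular_model one_modular_model mult_modular_model

lemma mult_mod_modulus: "(p::int) * (d mod p) mod p\<^sup>2 = p * d mod p\<^sup>2"
  by (simp add: power2_eq_square mod_mult_mult1)

text \<open>Modulo \<open>p^2\<close> the product \<open>d * p\<close> depends on d modulo p only.
  Reducing the exponent of y therefore does not affect its action on x.\<close>

lemma modular_twist_cong: "[a * (1 + (d mod p) * p) = a * (1 + d * p)] (mod (p::int)\<^sup>2)"
proof -
  have "[p * (d mod p) = p * d] (mod p\<^sup>2)"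
    using mult_mod_modulus by (simp add: cong_def)
  then have "[d mod p * p = d * p] (mod p\<^sup>2)" by (simp only: mult.commute)
  then show ?thesis by (rule cong_mult[OF cong_refl cong_add[OF cong_refl]])
qed

lemma group_modular_model:
  assumes "p > 0"
  shows "group (modular_model p)"
proof (rule groupI)
  fix x y z
  assume "x \<in> carrier (modular_model p)" "y \<in> carrier (modular_model p)" "z \<in> carrier (modular_model p)"
  obtain b a d c f e where [simp]: "x = (b, a)" "y = (d, c)" "z = (f, e)" by (metis surj_pair)
  have "[(a * (1 + d * int p) + c) mod (int p)\<^sup>2 * (1 + f * int p) + e
      = (a * (1 + d * int p) + c) * (1 + f * int p) + e] (mod (int p)\<^sup>2)"
    by (intro cong_add cong_mult cong_refl) (simp add: cong_def)
  also have "[(a * (1 + d * int p) + c) * (1 + f * int p) + e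
      = a * (1 + (d + f) * int p) + (c * (1 + f * int p) + e)] (mod (int p)\<^sup>2)"
    unfolding cong_iff_dvd_diff
    by (rule dvdI[of _ _ "a * d * f"]) (simp add: algebra_simps power2_eq_square)
  also have "[a * (1 + (d + f) * int p) + (c * (1 + f * int p) + e)
      = a * (1 + (d + f) mod int p * int p) + (c * (1 + f * int p) + e) mod (int p)\<^sup>2] (mod (int p)\<^sup>2)"
    by (intro cong_add cong_sym[OF modular_twist_cong]) (simp add: cong_def)
  finally show "x \<otimes>\<^bsub>modular_model p\<^esub> y \<otimes>\<^bsub>modular_model p\<^esub> z = x \<otimes>\<^bsub>modular_model p\<^esub> (y \<otimes>\<^bsub>modular_model p\<^esub> z)"
    by (simp add: mult_modular_model cong_def mod_simps add.assoc)
next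
  fix x assume "x \<in> carrier (modular_model p)"
  then obtain b a where x: "x = (b, a)" by (cases x)
  \<comment> \<open>The twist by \<open>- b\<close> inverts the twist by b, as
    \<open>(1 - b * p) * (1 + b * p)\<close> is 1 modulo \<open>p^2\<close>.\<close>
  let ?y = "((- b) mod int p, (- a * (1 - b * int p)) mod (int p)\<^sup>2)"
  have "[(- a * (1 - b * int p)) mod (int p)\<^sup>2 * (1 + b * int p) + a
      = - a * (1 - b * int p) * (1 + b * int p) + a] (mod (int p)\<^sup>2)"
    by (intro cong_add cong_mult cong_refl) (simp add: cong_def)
  also have "[- a * (1 - b * int p) * (1 + b * int p) + a = 0] (mod (int p)\<^sup>2)"
    unfolding cong_iff_dvd_diff
    by (rule dvdI[of _ _ "a * b * b"]) (simp add: algebra_simps power2_eq_square)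
  finally have "?y \<otimes>\<^bsub>modular_model p\<^esub> x = \<one>\<^bsub>modular_model p\<^esub>"
    by (simp add: x modular_model_simps cong_def mod_simps)
  moreover have "?y \<in> carrier (modular_model p)" using assms by (simp add: modular_model_simps)
  ultimately show "\<exists>y\<in>carrier (modular_model p). y \<otimes>\<^bsub>modular_model p\<^esub> x = \<one>\<^bsub>modular_model p\<^esub>"
    by blast
qed (use assms in \<open>auto simp: modular_model_simps\<close>)

lemma order_modular_model: "order (modular_model p) = p ^ 3"
  by (simp add: order_def carrier_modular_model power2_eq_square power3_eq_cube flip: of_nat_mult)

text \<open>The second coordinate accumulates \<open>a * (1 + i * b * p)\<close> for i below n; the
  sum of these i is the binomial coefficient n over 2.\<close>

lemma pow_modular_model:
  "(b, a) [^]\<^bsub>modular_model p\<^esub> (n::nat) =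
    ((int n * b) mod int p, (a * (int n + b * int p * (int n * (int n - 1) div 2))) mod (int p)\<^sup>2)"
proof (induction n)
  case 0
  show ?case by (simp add: one_modular_model)
next
  case (Suc n)
  let ?t = "int n * (int n - 1) div 2"
  have t: "int (Suc n) * (int (Suc n) - 1) div 2 = ?t + int n"
  proof -
    have "int (Suc n) * (int (Suc n) - 1) = int n * (int n - 1) + 2 * int n" by (simp add: algebra_simps)
    then show ?thesis by simp
  qed
  have "[a * (int n + b * int p * ?t) mod (int p)\<^sup>2 * (1 + b * int p) + a
      = a * (int n + b * int p * ?t) * (1 + b * int p) + a] (mod (int p)\<^sup>2)"
    by (intro cong_add cong_mult cong_refl) (simp add: cong_def)
  also have "[a * (int n + b * int p * ?t) * (1 + b * int p) + a
      = a * (int (Suc n) + b * int p * (?t + int n))] (mod (int p)\<^sup>2)"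
    unfolding cong_iff_dvd_diff
    by (rule dvdI[of _ _ "a * b * b * ?t"]) (simp add: algebra_simps power2_eq_square)
  finally show ?case
    unfolding nat_pow_Suc Suc.IH t by (simp add: mult_modular_model cong_def mod_simps algebra_simps)
qed

text \<open>For odd p the binomial coefficient p over 2 is a multiple of p, so the twist term
  vanishes modulo \<open>p^2\<close>.\<close>

lemma pow_p_modular_model:
  assumes "odd p"
  shows "(b, a) [^]\<^bsub>modular_model p\<^esub> p = (0, (a * int p) mod (int p)\<^sup>2)"
proof -
  obtain k where k: "p = 2 * k + 1" using assms by (rule oddE)
  then have "int p * (int p - 1) div 2 = int p * int k" by simp
  then have "[a * (int p + b * int p * (int p * (int p - 1) div 2)) = a * int p] (mod (int p)\<^sup>2)"
    unfolding cong_iff_dvd_diff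
    by (intro dvdI[of _ _ "a * b * int k"]) (simp add: algebra_simps power2_eq_square)
  then show ?thesis by (simp add: pow_modular_model cong_def)
qed

lemma mult_p_mod_square_eq_0_iff:
  "p > 0 \<Longrightarrow> (a * int p) mod (int p)\<^sup>2 = 0 \<longleftrightarrow> int p dvd a"
  by (simp add: power2_eq_square flip: dvd_eq_mod_eq_0)

lemma exponent_p_modular_model:
  assumes "odd p"
  shows "{x \<in> carrier (modular_model p). x [^]\<^bsub>modular_model p\<^esub> p = \<one>\<^bsub>modular_model p\<^esub>} =
    {0..<int p} \<times> (\<lambda>c. c * int p) ` {0..<int p}" (is "?L = ?R")
proof -
  have p: "p > 0" using assms by (rule odd_pos)
  have "?L = {(b, a). b \<in> {0..<int p} \<and> a \<in> {0..<(int p)\<^sup>2} \<and> int p dvd a}"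
    using p by (auto simp: modular_model_simps pow_p_modular_model[OF assms] mult_p_mod_square_eq_0_iff)
  also have "\<dots> = ?R"
  proof -
    have "a \<in> (\<lambda>c. c * int p) ` {0..<int p}" if "0 \<le> a" "a < (int p)\<^sup>2" "int p dvd a" for a
    proof -
      obtain c where c: "a = c * int p" using \<open>int p dvd a\<close> by (metis dvdE mult.commute)
      then have "0 \<le> c" "c < int p"
        using that p by (simp_all add: zero_le_mult_iff power2_eq_square)
      then show ?thesis using c by simp
    qed
    then show ?thesis using p by (auto simp: power2_eq_square)
  qed
  finally show ?thesis .
qed

text \<open>Membership means that p divides the second coordinate, a condition preserved by
  products; the rectangular description gives the size.\<close>

lemma subgroup_exponent_p_modular_model:
  assumes "odd p"
  defines "\<Omega> \<equiv> {x \<in> carrier (modular_model p). x [^]\<^bsub>modular_model p\<^esub> p = \<one>\<^bsub>modular_model p\<^esub>}"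
  shows "subgroup \<Omega> (modular_model p)" "card \<Omega> = p\<^sup>2"
proof -
  have p: "p > 0" using assms by (simp add: odd_pos)
  interpret group "modular_model p" using p by (rule group_modular_model)
  have \<Omega>: "\<Omega> = {x \<in> carrier (modular_model p). int p dvd snd x}"
    using p by (auto simp: \<Omega>_def one_modular_model pow_p_modular_model[OF assms(1)] mult_p_mod_square_eq_0_iff)
  have mult: "int p dvd snd (x \<otimes>\<^bsub>modular_model p\<^esub> y)"
    if "int p dvd snd x" "int p dvd snd y" for x y
    using that by (cases x, cases y) (simp add: mult_modular_model dvd_mod)
  show "subgroup \<Omega> (modular_model p)"
  proof (rule subgroupI)
    fix x assume x: "x \<in> \<Omega>"
    then have "inv\<^bsub>modular_model p\<^esub> x [^]\<^bsub>modular_model p\<^esub> p = \<one>\<^bsub>modular_model p\<^esub>"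
      by (simp add: \<Omega>_def nat_pow_inv)
    with x show "inv\<^bsub>modular_model p\<^esub> x \<in> \<Omega>" by (simp add: \<Omega>_def)
  next
    have "\<one>\<^bsub>modular_model p\<^esub> \<in> \<Omega>" by (simp add: \<Omega>_def)
    then show "\<Omega> \<noteq> {}" by blast
  qed (use mult in \<open>auto simp: \<Omega>\<close>)
  show "card \<Omega> = p\<^sup>2"
    unfolding \<Omega>_def exponent_p_modular_model[OF assms(1)]
    using p by (simp add: card_cartesian_product card_image inj_on_def power2_eq_square)
qed

section \<open>Rewriting words to the form \<open>y^b x^a\<close>\<close>

lemma (in group) pow_mod_eq:
  assumes "x \<in> carrier G" "x [^] (n::nat) = \<one>"
  shows "x [^] (k mod n) = x [^] k"
proof -
  have "x [^] k = x [^] (n * (k div n) + k mod n)" by simp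
  also have "\<dots> = (x [^] n) [^] (k div n) \<otimes> x [^] (k mod n)"
    using assms(1) by (simp only: nat_pow_mult nat_pow_pow)
  finally show ?thesis using assms by simp
qed

lemma (in group) inv_eq_pow_pred:
  assumes "x \<in> carrier G" "x [^] n = \<one>" "n > (0::nat)"
  shows "inv x = x [^] (n - 1)"
proof (rule inv_equality)
  show "x [^] (n - 1) \<otimes> x = \<one>" using assms by (simp flip: nat_pow_Suc)
qed (use assms in simp_all)

text \<open>Moving a power of x past one y multiplies its exponent by m, and this is repeated b
  times.\<close>

lemma (in group) pow_commute_twisted:
  assumes "x \<in> carrier G" "y \<in> carrier G" "x \<otimes> y = y \<otimes> x [^] (m::nat)"
  shows "x [^] (k::nat) \<otimes> y [^] (b::nat) = y [^] b \<otimes> x [^] (k * m ^ b)"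
proof (induction b)
  case (Suc b)
  have step: "x [^] (k::nat) \<otimes> y = y \<otimes> x [^] (k * m)" for k
  proof (induction k)
    case (Suc k)
    have "x [^] Suc k \<otimes> y = x [^] k \<otimes> (x \<otimes> y)" using assms(1,2) by (simp add: m_assoc)
    also have "\<dots> = (x [^] k \<otimes> y) \<otimes> x [^] m" using assms by (simp add: m_assoc)
    also have "\<dots> = y \<otimes> x [^] (Suc k * m)"
      using assms(1,2) by (simp add: Suc m_assoc nat_pow_mult add.commute)
    finally show ?case .
  qed (use assms(1,2) in simp)
  have "x [^] k \<otimes> y [^] Suc b = (x [^] k \<otimes> y [^] b) \<otimes> y" using assms(1,2) by (simp add: m_assoc)
  also have "\<dots> = y [^] b \<otimes> (x [^] (k * m ^ b) \<otimes> y)" using assms(1,2) by (simp add: Suc m_assoc)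
  also have "\<dots> = y [^] Suc b \<otimes> x [^] (k * m ^ Suc b)"
    using assms(1,2) by (simp add: step m_assoc mult_ac)
  finally show ?case .
qed (use assms(1,2) in simp)

lemma word_class_in_carrier [simp]: "word_class R w \<in> carrier (presented_group R)"
  by (simp add: presented_group_def)

lemma one_presented_group: "\<one>\<^bsub>presented_group R\<^esub> = word_class R []"
  by (simp add: presented_group_def)

lemma word_class_Cons:
  "word_class R (l # w) = word_class R [l] \<otimes>\<^bsub>presented_group R\<^esub> word_class R w"
  by (simp add: mult_word_class)

lemma word_class_replicate:
  "word_class R (replicate n l) = word_class R [l] [^]\<^bsub>presented_group R\<^esub> n"
proof (induction n)
  case (Suc n)
  interpret group "presented_group R" by (rule group_presented_group)
  have "word_class R (replicate (Suc n) l) = word_class R [l] \<otimes>\<^bsub>presented_group R\<^esub> word_class R (replicate n l)"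
    by (simp only: replicate_Suc word_class_Cons[of R l "replicate n l"])
  also have "\<dots> = word_class R [l] [^]\<^bsub>presented_group R\<^esub> Suc n"
    unfolding Suc by (rule nat_pow_Suc2[symmetric]) simp
  finally show ?case .
qed (simp add: one_presented_group)

lemma word_class_Inv: "word_class R [Inv g] = inv\<^bsub>presented_group R\<^esub> word_class R [Gen g]"
proof -
  interpret group "presented_group R" by (rule group_presented_group)
  show ?thesis
    by (rule inv_equality[symmetric])
      (simp_all add: mult_word_class one_presented_group word_class_eq_iff word_eq.inv_gen)
qed

text \<open>The conjugation relation moves powers of y to the left, and the power relations reduce
  the exponents. The inclusion bounds the size of the group by \<open>p^3\<close>.\<close>

lemma modular_group_normal_form:
  assumes "p > 0"
  obtains x y where "x \<in> carrier (modular_group p)" "y \<in> carrier (modular_group p)"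
    "carrier (modular_group p) \<subseteq>
      (\<lambda>(b, a). y [^]\<^bsub>modular_group p\<^esub> b \<otimes>\<^bsub>modular_group p\<^esub> x [^]\<^bsub>modular_group p\<^esub> a) ` ({..<p} \<times> {..<p\<^sup>2})"
proof -
  define R where "R = {(replicate (p\<^sup>2) (Gen X_gen), []), (replicate p (Gen Y_gen), []),
     ([Inv Y_gen, Gen X_gen, Gen Y_gen], replicate (p + 1) (Gen X_gen))}"
  have P: "modular_group p = presented_group R" by (simp add: modular_group_def R_def)
  interpret group "presented_group R" by (rule group_presented_group)
  define x where "x = word_class R [Gen X_gen]"
  define y where "y = word_class R [Gen Y_gen]"
  have xy [simp]: "x \<in> carrier (presented_group R)" "y \<in> carrier (presented_group R)"
    by (simp_all add: x_def y_def)
  have rel: "word_class R u = word_class R v" if "(u, v) \<in> R" for u v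
    using that by (simp add: word_class_eq_iff word_eq.rel)
  have xp: "x [^]\<^bsub>presented_group R\<^esub> (p\<^sup>2) = \<one>\<^bsub>presented_group R\<^esub>"
    unfolding x_def one_presented_group word_class_replicate[symmetric] by (rule rel) (simp add: R_def)
  have yp: "y [^]\<^bsub>presented_group R\<^esub> p = \<one>\<^bsub>presented_group R\<^esub>"
    unfolding y_def one_presented_group word_class_replicate[symmetric] by (rule rel) (simp add: R_def)
  have "inv\<^bsub>presented_group R\<^esub> y \<otimes>\<^bsub>presented_group R\<^esub> (x \<otimes>\<^bsub>presented_group R\<^esub> y) = x [^]\<^bsub>presented_group R\<^esub> (p + 1)"
    unfolding x_def y_def word_class_Inv[symmetric] mult_word_class word_class_replicate[symmetric]
    by (rule rel) (simp add: R_def)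
  then have twist: "x \<otimes>\<^bsub>presented_group R\<^esub> y = y \<otimes>\<^bsub>presented_group R\<^esub> x [^]\<^bsub>presented_group R\<^esub> (p + 1)"
    using inv_solve_left[of "x [^]\<^bsub>presented_group R\<^esub> (p + 1)" y "x \<otimes>\<^bsub>presented_group R\<^esub> y"] by auto
  note comm = pow_commute_twisted[OF xy twist]
  \<comment> \<open>The power relations make inverse letters natural powers as well, with exponents
    \<open>p^2 - 1\<close> and \<open>p - 1\<close>.\<close>
  have letter: "\<exists>k::nat. word_class R [l] = x [^]\<^bsub>presented_group R\<^esub> k \<or> word_class R [l] = y [^]\<^bsub>presented_group R\<^esub> k" for l
  proof (cases l)
    case (Gen g)
    then have "word_class R [l] = x [^]\<^bsub>presented_group R\<^esub> (1::nat) \<or> word_class R [l] = y [^]\<^bsub>presented_group R\<^esub> (1::nat)"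
      by (cases g) (simp_all add: x_def y_def)
    then show ?thesis by blast
  next
    case (Inv g)
    then have "word_class R [l] = x [^]\<^bsub>presented_group R\<^esub> (p\<^sup>2 - 1) \<or> word_class R [l] = y [^]\<^bsub>presented_group R\<^esub> (p - 1)"
      using inv_eq_pow_pred[OF xy(1) xp] inv_eq_pow_pred[OF xy(2) yp] assms
      by (cases g) (simp_all add: x_def y_def word_class_Inv)
    then show ?thesis by blast
  qed
  have word: "\<exists>(b::nat) (a::nat). word_class R w = y [^]\<^bsub>presented_group R\<^esub> b \<otimes>\<^bsub>presented_group R\<^esub> x [^]\<^bsub>presented_group R\<^esub> a" for w
  proof (induction w)
    case Nil
    have "word_class R [] = y [^]\<^bsub>presented_group R\<^esub> (0::nat) \<otimes>\<^bsub>presented_group R\<^esub> x [^]\<^bsub>presented_group R\<^esub> (0::nat)"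
      by (simp flip: one_presented_group)
    then show ?case by (intro exI)
  next
    case (Cons l w)
    then obtain b a :: nat where w: "word_class R w = y [^]\<^bsub>presented_group R\<^esub> b \<otimes>\<^bsub>presented_group R\<^esub> x [^]\<^bsub>presented_group R\<^esub> a"
      by blast
    obtain k :: nat where "word_class R [l] = x [^]\<^bsub>presented_group R\<^esub> k \<or> word_class R [l] = y [^]\<^bsub>presented_group R\<^esub> k"
      using letter by blast
    then show ?case
    proof
      assume "word_class R [l] = x [^]\<^bsub>presented_group R\<^esub> k"
      then have "word_class R (l # w)
          = (x [^]\<^bsub>presented_group R\<^esub> k \<otimes>\<^bsub>presented_group R\<^esub> y [^]\<^bsub>presented_group R\<^esub> b) \<otimes>\<^bsub>presented_group R\<^esub> x [^]\<^bsub>presented_group R\<^esub> a"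
        by (simp add: word_class_Cons[of R l w] w m_assoc)
      also have "\<dots> = y [^]\<^bsub>presented_group R\<^esub> b \<otimes>\<^bsub>presented_group R\<^esub> x [^]\<^bsub>presented_group R\<^esub> (k * (p + 1) ^ b + a)"
        unfolding comm by (simp add: m_assoc nat_pow_mult)
      finally show ?thesis by blast
    next
      assume "word_class R [l] = y [^]\<^bsub>presented_group R\<^esub> k"
      then have "word_class R (l # w)
          = (y [^]\<^bsub>presented_group R\<^esub> k \<otimes>\<^bsub>presented_group R\<^esub> y [^]\<^bsub>presented_group R\<^esub> b) \<otimes>\<^bsub>presented_group R\<^esub> x [^]\<^bsub>presented_group R\<^esub> a"
        by (simp add: word_class_Cons[of R l w] w m_assoc)
      also have "\<dots> = y [^]\<^bsub>presented_group R\<^esub> (k + b) \<otimes>\<^bsub>presented_group R\<^esub> x [^]\<^bsub>presented_group R\<^esub> a"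
        by (simp add: nat_pow_mult)
      finally show ?thesis by blast
    qed
  qed
  have "carrier (presented_group R) \<subseteq>
    (\<lambda>(b, a). y [^]\<^bsub>presented_group R\<^esub> b \<otimes>\<^bsub>presented_group R\<^esub> x [^]\<^bsub>presented_group R\<^esub> a) ` ({..<p} \<times> {..<p\<^sup>2})"
  proof
    fix z assume "z \<in> carrier (presented_group R)"
    then obtain w where "z = word_class R w" by (auto simp: presented_group_def)
    then obtain b a :: nat where z: "z = y [^]\<^bsub>presented_group R\<^esub> b \<otimes>\<^bsub>presented_group R\<^esub> x [^]\<^bsub>presented_group R\<^esub> a"
      using word by blast
    also have "\<dots> = y [^]\<^bsub>presented_group R\<^esub> (b mod p) \<otimes>\<^bsub>presented_group R\<^esub> x [^]\<^bsub>presented_group R\<^esub> (a mod p\<^sup>2)"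
      by (simp only: pow_mod_eq[OF xy(2) yp] pow_mod_eq[OF xy(1) xp])
    finally show "z \<in> (\<lambda>(b, a). y [^]\<^bsub>presented_group R\<^esub> b \<otimes>\<^bsub>presented_group R\<^esub> x [^]\<^bsub>presented_group R\<^esub> a) ` ({..<p} \<times> {..<p\<^sup>2})"
      using assms by (intro image_eqI[of _ _ "(b mod p, a mod p\<^sup>2)"]) simp_all
  qed
  then show ?thesis using that xy unfolding P by blast
qed

text \<open>The model satisfies the relations and is generated by \<open>x\<close> and \<open>y\<close>, so it is a quotient of the presented
  group; by the normal form the latter has at most \<open>p\<^sup>3\<close> elements, the order of the model.\<close>

lemma modular_group_iso_model:
  assumes p: "p > 1"
  shows "modular_group p \<cong> modular_model p"
proof -
  define R where "R = {(replicate (p\<^sup>2) (Gen X_gen), []), (replicate p (Gen Y_gen), []),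
     ([Inv Y_gen, Gen X_gen, Gen Y_gen], replicate (p + 1) (Gen X_gen))}"
  have P: "modular_group p = presented_group R" by (simp add: modular_group_def R_def)
  interpret M: group "modular_model p" using p by (intro group_modular_model) simp
  \<comment> \<open>In the coordinates \<open>(b, a)\<close> the generator x is
    \<open>(0, 1)\<close> and y is \<open>(1, 0)\<close>.\<close>
  define f where "f g = (if g = X_gen then (0, 1) else (1, 0 :: int) :: int \<times> int)" for g
  have sq: "1 < (int p)\<^sup>2" using p by (simp add: power2_eq_square less_1_mult)
  have f: "range f \<subseteq> carrier (modular_model p)"
    using p sq by (auto simp: f_def carrier_modular_model)
  have fX: "f X_gen [^]\<^bsub>modular_model p\<^esub> n = (0, int n mod (int p)\<^sup>2)"
    and fY: "f Y_gen [^]\<^bsub>modular_model p\<^esub> n = (int n mod int p, 0)" for n :: nat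
    by (simp_all add: f_def pow_modular_model)
  have fc: "f g \<in> carrier (modular_model p)" for g using f by auto
  have "f X_gen \<otimes>\<^bsub>modular_model p\<^esub> f Y_gen
      = f Y_gen \<otimes>\<^bsub>modular_model p\<^esub> f X_gen [^]\<^bsub>modular_model p\<^esub> (p + 1)"
    unfolding fX by (simp add: f_def mult_modular_model mod_simps add.commute)
  then have twist: "inv\<^bsub>modular_model p\<^esub> f Y_gen \<otimes>\<^bsub>modular_model p\<^esub> (f X_gen \<otimes>\<^bsub>modular_model p\<^esub> f Y_gen)
      = f X_gen [^]\<^bsub>modular_model p\<^esub> (p + 1)"
    using fc M.m_assoc[of "inv\<^bsub>modular_model p\<^esub> f Y_gen" "f Y_gen" "f X_gen [^]\<^bsub>modular_model p\<^esub> (p + 1)"]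
    by (simp del: M.nat_pow_Suc)
  have rel: "eval_word (modular_model p) f u = eval_word (modular_model p) f v" if "(u, v) \<in> R" for u v
  proof -
    have "eval_word (modular_model p) f (replicate (p\<^sup>2) (Gen X_gen)) = \<one>\<^bsub>modular_model p\<^esub>"
      "eval_word (modular_model p) f (replicate p (Gen Y_gen)) = \<one>\<^bsub>modular_model p\<^esub>"
      by (simp_all add: M.eval_word_replicate_Gen[OF f] fX fY one_modular_model)
    moreover have "eval_word (modular_model p) f [Inv Y_gen, Gen X_gen, Gen Y_gen]
        = eval_word (modular_model p) f (replicate (p + 1) (Gen X_gen))"
      unfolding M.eval_word_replicate_Gen[OF f] using twist fc by (simp add: eval_letter_def)
    ultimately show ?thesis using that unfolding R_def by auto
  qed
  obtain h where h: "h \<in> hom (presented_group R) (modular_model p)"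
    "\<And>w. h (word_class R w) = eval_word (modular_model p) f w"
    using M.presented_group_hom[OF f rel] by blast
  have surj: "h ` carrier (presented_group R) = carrier (modular_model p)"
  proof (intro equalityI subsetI)
    fix z assume "z \<in> carrier (modular_model p)"
    then obtain b a where z: "z = (b, a)" "0 \<le> b" "b < int p" "0 \<le> a" "a < (int p)\<^sup>2"
      by (auto simp: carrier_modular_model)
    have "h (word_class R (replicate (nat b) (Gen Y_gen) @ replicate (nat a) (Gen X_gen))) = z"
      unfolding h(2) M.eval_word_append[OF f] M.eval_word_replicate_Gen[OF f] fX fY
      using z by (simp add: mult_modular_model)
    then show "z \<in> h ` carrier (presented_group R)" by (metis image_eqI word_class_in_carrier)
  qed (use h(1) in \<open>auto simp: hom_def\<close>)
  have p0: "p > 0" using p by simp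
  obtain x y where "x \<in> carrier (modular_group p)" "y \<in> carrier (modular_group p)"
    and sub: "carrier (modular_group p) \<subseteq>
      (\<lambda>(b, a). y [^]\<^bsub>modular_group p\<^esub> b \<otimes>\<^bsub>modular_group p\<^esub> x [^]\<^bsub>modular_group p\<^esub> a) ` ({..<p} \<times> {..<p\<^sup>2})"
    by (rule modular_group_normal_form[OF p0])
  note sub = sub[unfolded P]
  then have fin: "finite (carrier (presented_group R))" by (rule finite_subset) simp
  have "card (carrier (presented_group R)) \<le> card ({..<p} \<times> {..<p\<^sup>2})"
    using sub by (rule surj_card_le[rotated]) simp
  also have "\<dots> = card (carrier (modular_model p))"
    using order_modular_model[of p]
    by (simp add: order_def card_cartesian_product power2_eq_square power3_eq_cube)
  \<comment> \<open>A surjection from a finite set onto one at least as large is injective.\<close>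
  finally have "inj_on h (carrier (presented_group R))"
    using fin card_image_le[OF fin, of h] surj by (intro eq_card_imp_inj_on) auto
  with h(1) surj have "h \<in> iso (presented_group R) (modular_model p)" by (simp add: iso_def bij_betw_def)
  then show ?thesis unfolding P by (rule is_isoI)
qed

section \<open>Density\<close>

lemma modular_group_facts:
  assumes "prime p" "odd p"
  shows "group (modular_group p)" "finite (carrier (modular_group p))" "order (modular_group p) = p ^ 3"
    "cdeg (modular_group p) = (real p + 1) / (real p + 2)"
proof -
  have p: "p > 1" using assms(1) by (rule prime_gt_1_nat)
  interpret M: group "modular_model p" using p by (intro group_modular_model) simp
  have iso: "modular_group p \<cong> modular_model p" using p by (rule modular_group_iso_model)
  show grp: "group (modular_group p)" by (simp add: modular_group_def group_presented_group)
  show "finite (carrier (modular_group p))"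
    using iso_finite[OF iso] by (simp add: carrier_modular_model)
  show "order (modular_group p) = p ^ 3"
    using iso_same_card[OF iso] order_modular_model[of p] by (simp add: order_def)
  \<comment> \<open>The p-th power of \<open>(b, a)\<close> is \<open>(0, a * p)\<close>, whose p-th
    power has second coordinate \<open>a * p^2\<close>, which is 0 modulo
    \<open>p^2\<close>.\<close>
  have exp: "x [^]\<^bsub>modular_model p\<^esub> (p\<^sup>2) = \<one>\<^bsub>modular_model p\<^esub>" if "x \<in> carrier (modular_model p)" for x
  proof -
    have "x [^]\<^bsub>modular_model p\<^esub> (p\<^sup>2) = (x [^]\<^bsub>modular_model p\<^esub> p) [^]\<^bsub>modular_model p\<^esub> p"
      using that by (simp add: M.nat_pow_pow power2_eq_square)
    then show ?thesis
      by (cases x) (simp add: pow_p_modular_model[OF assms(2)] one_modular_model mod_simps,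
        simp add: power2_eq_square)
  qed
  have "cdeg (modular_model p) = (2 * real p + 2) / (2 * real p + 4)"
    using M.card_subgroups_order_p_cubed[OF assms(1) order_modular_model
        subgroup_exponent_p_modular_model[OF assms(2)] exp]
    by (simp add: cdeg_def)
  also have "\<dots> = (real p + 1) / (real p + 2)" by (simp add: field_simps)
  finally show "cdeg (modular_group p) = (real p + 1) / (real p + 2)"
    using cdeg_iso[OF grp M.is_group iso] by simp
qed

lemma cdeg_product_modular_groups:
  assumes "finite Q" "\<And>q. q \<in> Q \<Longrightarrow> prime q \<and> odd q"
  shows "cdeg (product_group Q modular_group) = (\<Prod>q\<in>Q. (real q + 1) / (real q + 2))"
proof -
  have "cdeg (product_group Q modular_group) = (\<Prod>q\<in>Q. cdeg (modular_group q))"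
    using assms modular_group_facts
    by (intro cdeg_product_group_coprime) (auto simp: pairwise_def primes_coprime)
  also have "\<dots> = (\<Prod>q\<in>Q. (real q + 1) / (real q + 2))"
    using assms(2) modular_group_facts(4) by (intro prod.cong) auto
  finally show ?thesis .
qed

lemma CD_subset: "class_of_finite_groups \<C> \<Longrightarrow> CD \<C> \<subseteq> {0..1}"
  using cdeg_bounds by (fastforce simp: CD_def class_of_finite_groups_def)

lemma CD_dense:
  fixes \<C> :: "('a, 'b) monoid_scheme set"
  assumes "class_of_finite_groups \<C>" "contains_modular_products \<C>"
  shows "{0..1} \<subseteq> closure (CD \<C>)"
proof -
  have "a \<in> closure (CD \<C>)" if a: "0 \<le> a" "a < 1" for a
  proof (subst closure_approachable, intro allI impI)
    fix \<epsilon> :: real assume "\<epsilon> > 0"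
    obtain Q :: "nat set" where Q: "finite Q" "Q \<noteq> {}" "\<And>q. q \<in> Q \<Longrightarrow> prime q \<and> odd q"
      "\<bar>(\<Prod>q\<in>Q. (real q + 1) / (real q + 2)) - a\<bar> < \<epsilon>"
      using prime_products_dense[OF a \<open>\<epsilon> > 0\<close>] by blast
    then obtain G where G: "G \<in> \<C>" "G \<cong> product_group Q modular_group"
      using assms(2) unfolding contains_modular_products_def by blast
    have "group (product_group Q modular_group)"
      using Q(3) modular_group_facts(1) by (intro product_group) auto
    then have "cdeg G = cdeg (product_group Q modular_group)"
      using G assms(1) by (intro cdeg_iso) (auto simp: class_of_finite_groups_def)
    also have "\<dots> = (\<Prod>q\<in>Q. (real q + 1) / (real q + 2))"
      using Q by (intro cdeg_product_modular_groups) auto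
    finally have "dist (cdeg G) a < \<epsilon>" using Q(4) by (simp add: dist_real_def)
    then show "\<exists>y\<in>CD \<C>. dist y a < \<epsilon>" using G(1) by (auto simp: CD_def)
  qed
  \<comment> \<open>The endpoint 1 is reached as a limit of the points below it.\<close>
  then have "closure {0..<1} \<subseteq> closure (CD \<C>)" by (intro closure_minimal) auto
  then show ?thesis by simp
qed

lemma contains_modular_products_all_nat_groups:
  "contains_modular_products {G :: nat monoid. group G \<and> finite (carrier G)}"
  unfolding contains_modular_products_def
proof (intro allI impI)
  fix Q :: "nat set"
  assume "finite Q \<and> Q \<noteq> {} \<and> (\<forall>q\<in>Q. prime q \<and> odd q)"
  then have "group (product_group Q modular_group)" "finite (carrier (product_group Q modular_group))"
    using modular_group_facts(1,2) by (auto intro!: product_group finite_PiE)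
  then obtain H :: "nat monoid" where "group H" "finite (carrier H)" "H \<cong> product_group Q modular_group"
    by (rule finite_group_iso_nat)
  then show "\<exists>G\<in>{G :: nat monoid. group G \<and> finite (carrier G)}. G \<cong> product_group Q modular_group"
    by blast
qed

theorem corollary3p3:
  shows "(\<forall>\<M> \<C> :: 'a monoid set.
            class_of_finite_groups \<M> \<and> contains_modular_products \<M> \<and>
            class_of_finite_groups \<C> \<and> \<M> \<subseteq> \<C> \<longrightarrow>
            CD \<C> \<subseteq> {0..1} \<and> {0..1} \<subseteq> closure (CD \<C>)) \<and>
         (\<forall>a::real. a \<in> {0..1} \<longrightarrow>
            (\<exists>G :: nat \<Rightarrow> nat monoid.
               (\<forall>n\<ge>1. group (G n) \<and> finite (carrier (G n))) \<and>
               (\<lambda>n. cdeg (G n)) \<longlonglongrightarrow> a))"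
proof (intro conjI allI impI)
  fix \<M> \<C> :: "'a monoid set"
  assume *: "class_of_finite_groups \<M> \<and> contains_modular_products \<M> \<and>
    class_of_finite_groups \<C> \<and> \<M> \<subseteq> \<C>"
  then have "contains_modular_products \<C>"
    unfolding contains_modular_products_def by blast
  with * show "CD \<C> \<subseteq> {0..1}" "{0..1} \<subseteq> closure (CD \<C>)"
    by (auto dest: CD_subset CD_dense)
next
  fix a :: real assume "a \<in> {0..1}"
  define \<C> where "\<C> = {G :: nat monoid. group G \<and> finite (carrier G)}"
  have "a \<in> closure (CD \<C>)"
    using CD_dense[of \<C>] contains_modular_products_all_nat_groups \<open>a \<in> {0..1}\<close>
    by (auto simp: \<C>_def class_of_finite_groups_def)
  \<comment> \<open>A point of the closure is the limit of a sequence of cyclicity degrees; groups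
    realizing its terms are then chosen.\<close>
  then obtain s where s: "\<And>n. s n \<in> CD \<C>" "s \<longlonglongrightarrow> a"
    by (auto simp: closure_sequential)
  then have "\<forall>n. \<exists>G. G \<in> \<C> \<and> s n = cdeg G" by (force simp: CD_def)
  then obtain G where G: "\<And>n. G n \<in> \<C>" "\<And>n. s n = cdeg (G n)" by metis
  then have "s = (\<lambda>n. cdeg (G n))" by blast
  with s(2) G(1) show "\<exists>G :: nat \<Rightarrow> nat monoid.
      (\<forall>n\<ge>1. group (G n) \<and> finite (carrier (G n))) \<and> (\<lambda>n. cdeg (G n)) \<longlonglongrightarrow> a"
    by (intro exI[of _ G]) (auto simp: \<C>_def)
qed

end
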